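(* For all $0<\alpha<\tfrac12$ and $d\in\mathbb R$ with $2d+2\alpha<1$, with $\kappa=1-d-\alpha>\tfrac12$, $$\Lambda_2(\alpha,d)=\frac{\mathcal D_{2,\kappa}}{\sqrt{2\mathcal Z_{2\alpha,\kappa}}}.$$ For each fixed $0<\alpha<1/2$, as $d\to-\infty$, $$\Lambda_2(\alpha,d)=\Lambda_2^{\exp}(\alpha)\bigl[1+O((1-d)^{-2})\bigr],\qquad \Lambda_2^{\exp}(\alpha)=\frac{\lambda_{\max}(S_{\alpha,\infty})}{\sqrt{2\Gamma(1-2\alpha)}}>0.$$
   Context: For $0<\alpha<1/2$ and $d\in\mathbb R$ with $2d+2\alpha<1$, let $T_{\alpha,d}$ be the positive Hilbert--Schmidt operator on $L^2(0,1)$, $(T_{\alpha,d}f)(x)=\int_0^1x^{-d/2}y^{-d/2}|x-y|^{-\alpha}f(y)\,dy$, and define the rank-two LIL constant $$\Lambda_2(\alpha,d)=\frac{\lambda_{\max}(T_{\alpha,d})}{\sqrt{2\operatorname{tr}(T_{\alpha,d}^2)}},\qquad \operatorname{tr}(T_{\alpha,d}^2)=\int_0^1\!\!\int_0^1x^{-d}y^{-d}|x-y|^{-2\alpha}\,dx\,dy.$$ Let $\nu(du)=e^{-u}\,du$ on $[0,\infty)$. For $\kappa>1/2$ set $$k_{\alpha,\kappa}(u,v)=\Bigl[2\kappa\sinh\Bigl(\frac{|u-v|}{2\kappa}\Bigr)\Bigr]^{-\alpha},\qquad k_{\alpha,\infty}(u,v)=|u-v|^{-\alpha},$$ $$\mathcal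 Z_{s,\kappa}=\kappa^{1-s}B(\kappa+s/2,1-s),\qquad \mathcal Z_{s,\infty}=\Gamma(1-s)$$ ($B$ the beta function; used with $s=2\alpha$). For $\kappa\in(1/2,\infty]$, $S_{\alpha,\kappa}$ is the integral operator on $L^2(\nu)$ with kernel $k_{\alpha,\kappa}$ with respect to $\nu$, i.e. $(S_{\alpha,\kappa}h)(u)=\int_0^\infty k_{\alpha,\kappa}(u,v)h(v)e^{-v}\,dv$, and $\mathcal D_{2,\kappa}=\lambda_{\max}(S_{\alpha,\kappa})$. *)

theory Defs
  imports "HOL-Analysis.Analysis" "HOL-Library.Landau_Symbols"
begin

text \<open>
  Elements of \<open>L\<^sup>2(M)\<close> are represented by real-valued square-integrable functions, and equality
  in \<open>L\<^sup>2(M)\<close> is equality almost everywhere. Restricting to real scalars loses nothing,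
  since the operators below are self-adjoint with real kernels.
\<close>

definition L2 :: "'a measure \<Rightarrow> ('a \<Rightarrow> real) set" where
  "L2 M = {f \<in> borel_measurable M. integrable M (\<lambda>x. (f x)\<^sup>2)}"

definition L2_eigenvalue :: "'a measure \<Rightarrow> (('a \<Rightarrow> real) \<Rightarrow> 'a \<Rightarrow> real) \<Rightarrow> real \<Rightarrow> bool" where
  "L2_eigenvalue M T l \<longleftrightarrow>
     (\<exists>f\<in>L2 M. \<not> (AE x in M. f x = 0) \<and> (AE x in M. T f x = l * f x))"

definition lambda_max :: "'a measure \<Rightarrow> (('a \<Rightarrow> real) \<Rightarrow> 'a \<Rightarrow> real) \<Rightarrow> real" where
  "lambda_max M T = (GREATEST l. L2_eigenvalue M T l)"

abbreviation unit_leb :: "real measure" where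
  "unit_leb \<equiv> restrict_space lborel {0<..<1}"

text \<open>
  All kernels below are square-integrable for the parameters considered, so for \<open>f\<close> in \<open>L\<^sup>2\<close> the
  integral defining the operator converges at almost every point; the value 0 that
  the integral takes by convention elsewhere only matters on a null set. The same
  holds for the value of the kernels on the diagonal, where \<open>0 powr (-\<alpha>) = 0\<close>.
\<close>

definition T_op :: "real \<Rightarrow> real \<Rightarrow> (real \<Rightarrow> real) \<Rightarrow> real \<Rightarrow> real" where
  "T_op \<alpha> d f x =
     (LINT y|unit_leb. x powr (- d / 2) * y powr (- d / 2) * \<bar>x - y\<bar> powr (- \<alpha>) * f y)"

definition trace_T_sq :: "real \<Rightarrow> real \<Rightarrow> real" where
  "trace_T_sq \<alpha> d =
     (LINT x|unit_leb. LINT y|unit_leb. x powr (- d) * y powr (- d) * \<bar>x - y\<bar> powr (- 2 * \<alpha>))"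

definition Lambda2 :: "real \<Rightarrow> real \<Rightarrow> real" where
  "Lambda2 \<alpha> d = lambda_max unit_leb (T_op \<alpha> d) / sqrt (2 * trace_T_sq \<alpha> d)"

definition nu :: "real measure" where
  "nu = density (restrict_space lborel {0..}) (\<lambda>u. ennreal (exp (- u)))"

text \<open>
  The parameter \<open>\<kappa>\<close> ranges over \<open>(1/2, \<infinity>]\<close>; the values for \<open>-\<infinity>\<close> are irrelevant.
\<close>

definition kern :: "real \<Rightarrow> ereal \<Rightarrow> real \<Rightarrow> real \<Rightarrow> real" where
  "kern \<alpha> \<kappa> u v =
     (case \<kappa> of
        ereal r \<Rightarrow> (2 * r * sinh (\<bar>u - v\<bar> / (2 * r))) powr (- \<alpha>)
      | PInfty \<Rightarrow> \<bar>u - v\<bar> powr (- \<alpha>)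
      | MInfty \<Rightarrow> 0)"

definition Zconst :: "real \<Rightarrow> ereal \<Rightarrow> real" where
  "Zconst s \<kappa> =
     (case \<kappa> of
        ereal r \<Rightarrow> r powr (1 - s) * Beta (r + s / 2) (1 - s)
      | PInfty \<Rightarrow> Gamma (1 - s)
      | MInfty \<Rightarrow> 0)"

definition S_op :: "real \<Rightarrow> ereal \<Rightarrow> (real \<Rightarrow> real) \<Rightarrow> real \<Rightarrow> real" where
  "S_op \<alpha> \<kappa> h u = (LINT v|nu. kern \<alpha> \<kappa> u v * h v)"

definition D2 :: "real \<Rightarrow> ereal \<Rightarrow> real" where
  "D2 \<alpha> \<kappa> = lambda_max nu (S_op \<alpha> \<kappa>)"

definition Lambda2_exp :: "real \<Rightarrow> real" where
  "Lambda2_exp \<alpha> = lambda_max nu (S_op \<alpha> \<infinity>) / sqrt (2 * Gamma (1 - 2 * \<alpha>))"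

end

theory Submission
  imports Defs "HOL-Complex_Analysis.Great_Picard" "HOL-Probability.Distributions"
begin

text \<open>
The substitution \<open>x = exp (- u / \<kappa>)\<close> moves the operator from the unit interval to the exponential
measure. Since \<open>\<bar>x - y\<bar> = exp (- (u + v) / (2 * \<kappa>)) * 2 * sinh (\<bar>u - v\<bar> / (2 * \<kappa>))\<close>, the kernel of
the first operator becomes a constant times the \<open>sinh\<close> kernel times exponentials in \<open>u\<close> and \<open>v\<close>
(\<open>chart_kernel\<close>). Rescaling functions by the square root of the Jacobian leaves one more pair of
exponentials, and all of them cancel exactly when \<open>\<kappa> = 1 - d - \<alpha>\<close> (\<open>weight_kernel_cancel\<close>). So the
eigenvalues of the two operators agree up to the factor \<open>\<kappa> powr (\<alpha> - 1)\<close> (\<open>eigenvalue_transfer\<close>).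
In the same way the trace becomes \<open>\<kappa> powr (2 * \<alpha> - 2)\<close> times the double integral of the
squared \<open>sinh\<close> kernel. The distance of two independent standard exponential variables is again a
standard exponential variable (\<open>integral_nu_distance\<close>), which leaves a single integral, and
the same substitution turns this one into the beta integral (\<open>Zconst_real_eq\<close>). The powers of \<open>\<kappa>\<close> cancel
in the quotient.

For the asymptotics, \<open>1 - y\<^sup>2 \<le> y / sinh y \<le> 1\<close> squeezes the \<open>sinh\<close> kernel between the limit kernel
and the limit kernel minus \<open>(1 + u\<^sup>2) * (1 + v\<^sup>2) / (4 * \<kappa>\<^sup>2)\<close> (\<open>kern_infinity_le\<close>). The error bound is a
product of square-integrable functions, so it moves the largest eigenvalue by at most a constant
times \<open>1 / \<kappa>\<^sup>2\<close> (\<open>top_le_perturbation\<close>), and the normalizing integrals obey the same bound.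

All this needs that a largest eigenvalue exists and that it is the supremum of the quadratic form on
the unit sphere. For a non-negative symmetric kernel the operator norm is this supremum as well, so a
maximizing sequence consists of approximate eigenfunctions. The columns of the kernel depend
continuously on the point in the \<open>L\<^sup>2\<close> sense, hence the images of the sequence under the operator
converge pointwise along a subsequence, and the limit is an eigenfunction (\<open>top_eigenvalue\<close>).
\<close>

section \<open>Square-integrable functions\<close>

lemma L2_measurable [measurable_dest]: "f \<in> L2 M \<Longrightarrow> f \<in> borel_measurable M"
  by (simp add: L2_def)

lemma L2_square_integrable: "f \<in> L2 M \<Longrightarrow> integrable M (\<lambda>x. (f x)\<^sup>2)"
  by (simp add: L2_def)

lemma L2_mult_integrable:
  assumes "f \<in> L2 M" "g \<in> L2 M"
  shows "integrable M (\<lambda>x. f x * g x)"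
proof (rule Bochner_Integration.integrable_bound)
  show "integrable M (\<lambda>x. (f x)\<^sup>2 + (g x)\<^sup>2)"
    using assms by (intro Bochner_Integration.integrable_add L2_square_integrable)
  show "(\<lambda>x. f x * g x) \<in> borel_measurable M"
    using assms[THEN L2_measurable] by measurable
  show "AE x in M. norm (f x * g x) \<le> norm ((f x)\<^sup>2 + (g x)\<^sup>2)"
  proof (intro AE_I2)
    fix x
    have "2 * \<bar>f x\<bar> * \<bar>g x\<bar> \<le> \<bar>f x\<bar>\<^sup>2 + \<bar>g x\<bar>\<^sup>2" by (rule sum_squares_bound)
    moreover have "0 \<le> \<bar>f x\<bar> * \<bar>g x\<bar>" by simp
    ultimately show "norm (f x * g x) \<le> norm ((f x)\<^sup>2 + (g x)\<^sup>2)"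
      unfolding real_norm_def abs_mult power2_abs by linarith
  qed
qed

lemma L2_cmult: "f \<in> L2 M \<Longrightarrow> (\<lambda>x. c * f x) \<in> L2 M"
  by (auto simp: L2_def power_mult_distrib)

lemma L2_add:
  assumes "f \<in> L2 M" "g \<in> L2 M"
  shows "(\<lambda>x. f x + g x) \<in> L2 M"
proof -
  have "integrable M (\<lambda>x. (f x)\<^sup>2 + (g x)\<^sup>2 + 2 * (f x * g x))"
    using assms
    by (intro Bochner_Integration.integrable_add integrable_mult_right L2_square_integrable L2_mult_integrable)
  then have "integrable M (\<lambda>x. (f x + g x)\<^sup>2)"
    by (simp add: power2_sum mult.assoc)
  then show ?thesis using assms[THEN L2_measurable] by (simp add: L2_def)
qed

lemma L2_diff: "f \<in> L2 M \<Longrightarrow> g \<in> L2 M \<Longrightarrow> (\<lambda>x. f x - g x) \<in> L2 M"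
  using L2_add[of f M "\<lambda>x. (-1) * g x"] L2_cmult[of g M "-1"] by simp

lemma L2_abs: "f \<in> L2 M \<Longrightarrow> (\<lambda>x. \<bar>f x\<bar>) \<in> L2 M"
  by (auto simp: L2_def)

lemma (in finite_measure) L2_bounded:
  assumes [measurable]: "f \<in> borel_measurable M" and B: "\<And>x. x \<in> space M \<Longrightarrow> \<bar>f x\<bar> \<le> B"
  shows "f \<in> L2 M"
  unfolding L2_def
proof safe
  show "integrable M (\<lambda>x. (f x)\<^sup>2)"
    by (intro integrable_const_bound[where B = "B\<^sup>2"] AE_I2)
      (use B abs_le_square_iff in \<open>fastforce+\<close>)
qed simp

text \<open>
The quadratic polynomial \<open>t \<mapsto> \<integral>(f - t * g)\<^sup>2\<close> is non-negative, so its discriminant is not positive.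
\<close>

lemma L2_Cauchy_Schwarz:
  assumes f: "f \<in> L2 M" and g: "g \<in> L2 M"
  shows "(\<integral>x. f x * g x \<partial>M)\<^sup>2 \<le> (\<integral>x. (f x)\<^sup>2 \<partial>M) * (\<integral>x. (g x)\<^sup>2 \<partial>M)"
proof -
  define a b c where "a = (\<integral>x. (f x)\<^sup>2 \<partial>M)" and "b = (\<integral>x. f x * g x \<partial>M)"
    and "c = (\<integral>x. (g x)\<^sup>2 \<partial>M)"
  have quad: "0 \<le> a - 2 * t * b + t\<^sup>2 * c" for t
  proof -
    have "0 \<le> (\<integral>x. (f x - t * g x)\<^sup>2 \<partial>M)" by simp
    also have "(\<lambda>x. (f x - t * g x)\<^sup>2) = (\<lambda>x. (f x)\<^sup>2 - (2 * t) * (f x * g x) + t\<^sup>2 * (g x)\<^sup>2)"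
      by (auto simp: power2_eq_square algebra_simps)
    also have "(\<integral>x. (f x)\<^sup>2 - (2 * t) * (f x * g x) + t\<^sup>2 * (g x)\<^sup>2 \<partial>M) = a - 2 * t * b + t\<^sup>2 * c"
      using L2_square_integrable[OF f] L2_square_integrable[OF g] L2_mult_integrable[OF f g]
      by (simp add: a_def b_def c_def)
    finally show ?thesis .
  qed
  have "0 \<le> c" by (simp add: c_def)
  have "b\<^sup>2 \<le> a * c"
  proof (cases "c = 0")
    case True
    have "b = 0"
    proof (rule ccontr)
      assume "b \<noteq> 0"
      \<comment> \<open>this \<open>t\<close> makes \<open>a - 2 * t * b\<close> equal to \<open>- 1\<close>\<close>
      with quad[of "(a + 1) / (2 * b)"] True show False by simp
    qed
    with True show ?thesis by simp
  next
    case False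
    \<comment> \<open>the minimizer of the quadratic polynomial\<close>
    with \<open>0 \<le> c\<close> quad[of "b / c"] show ?thesis
      by (simp add: field_simps power2_eq_square)
  qed
  then show ?thesis by (simp add: a_def b_def c_def)
qed

section \<open>The top of the spectrum of a non-negative symmetric kernel\<close>

text \<open>
A uniform bound on the \<open>L\<^sup>2\<close> norms of the columns is stronger than the Hilbert--Schmidt condition. It
makes the image of a square-integrable function a bounded function that is defined at every point, which
spares all arguments about exceptional null sets.
\<close>

locale positive_kernel = finite_measure M for M :: "'a measure" +
  fixes k :: "'a \<Rightarrow> 'a \<Rightarrow> real" and C :: real
  assumes kernel_measurable [measurable]: "(\<lambda>(u, v). k u v) \<in> borel_measurable (M \<Otimes>\<^sub>M M)"
    and kernel_nonneg: "0 \<le> k u v"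
    and kernel_sym: "k u v = k v u"
    and column_L2: "u \<in> space M \<Longrightarrow> k u \<in> L2 M"
    and column_bound: "u \<in> space M \<Longrightarrow> (\<integral>v. (k u v)\<^sup>2 \<partial>M) \<le> C\<^sup>2"
    and bound_nonneg: "0 \<le> C"
    and space_not_null: "emeasure M (space M) \<noteq> 0"
    and kernel_pos: "u \<in> space M \<Longrightarrow> AE v in M. 0 < k u v"
begin

definition T :: "('a \<Rightarrow> real) \<Rightarrow> 'a \<Rightarrow> real" where
  "T f u = (\<integral>v. k u v * f v \<partial>M)"

definition form :: "('a \<Rightarrow> real) \<Rightarrow> ('a \<Rightarrow> real) \<Rightarrow> real" where
  "form f g = (\<integral>u. T f u * g u \<partial>M)"

definition form_sup :: real where
  "form_sup = (SUP f\<in>{f \<in> L2 M. (\<integral>u. (f u)\<^sup>2 \<partial>M) = 1}. form f f)"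

lemma column_integrable: "u \<in> space M \<Longrightarrow> f \<in> L2 M \<Longrightarrow> integrable M (\<lambda>v. k u v * f v)"
  by (intro L2_mult_integrable column_L2)

lemma T_measurable [measurable]:
  assumes "f \<in> L2 M"
  shows "T f \<in> borel_measurable M"
proof -
  have [measurable]: "f \<in> borel_measurable M" using assms by (rule L2_measurable)
  show ?thesis unfolding T_def by measurable
qed

lemma T_square_le:
  assumes "u \<in> space M" "f \<in> L2 M"
  shows "(T f u)\<^sup>2 \<le> C\<^sup>2 * (\<integral>v. (f v)\<^sup>2 \<partial>M)"
proof -
  have "(T f u)\<^sup>2 \<le> (\<integral>v. (k u v)\<^sup>2 \<partial>M) * (\<integral>v. (f v)\<^sup>2 \<partial>M)"
    unfolding T_def using assms by (intro L2_Cauchy_Schwarz column_L2)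
  also have "\<dots> \<le> C\<^sup>2 * (\<integral>v. (f v)\<^sup>2 \<partial>M)"
    by (intro mult_right_mono column_bound assms) simp
  finally show ?thesis .
qed

lemma T_abs_le:
  assumes "u \<in> space M" "f \<in> L2 M"
  shows "\<bar>T f u\<bar> \<le> C * sqrt (\<integral>v. (f v)\<^sup>2 \<partial>M)"
  using real_sqrt_le_mono[OF T_square_le[OF assms]] bound_nonneg by (simp add: real_sqrt_mult)

lemma T_L2: "f \<in> L2 M \<Longrightarrow> T f \<in> L2 M"
  by (rule L2_bounded[OF T_measurable T_abs_le])

lemma T_add: "u \<in> space M \<Longrightarrow> f \<in> L2 M \<Longrightarrow> g \<in> L2 M \<Longrightarrow> T (\<lambda>x. f x + g x) u = T f u + T g u"
  by (simp add: T_def distrib_left column_integrable)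

lemma T_diff: "u \<in> space M \<Longrightarrow> f \<in> L2 M \<Longrightarrow> g \<in> L2 M \<Longrightarrow> T (\<lambda>x. f x - g x) u = T f u - T g u"
  by (simp add: T_def right_diff_distrib column_integrable)

lemma T_cmult: "T (\<lambda>x. c * f x) u = c * T f u"
  by (simp add: T_def mult.left_commute)

lemma form_integrable:
  assumes f: "f \<in> L2 M" and g: "g \<in> L2 M"
  shows "integrable M (\<lambda>u. T f u * g u)"
  by (intro L2_mult_integrable T_L2 assms)

lemma form_sym:
  assumes f: "f \<in> L2 M" and g: "g \<in> L2 M"
  shows "form f g = form g f"
proof -
  interpret pair_sigma_finite M M ..
  have [measurable]: "f \<in> borel_measurable M" "g \<in> borel_measurable M"
    using f g by (auto dest: L2_measurable)
  have int: "integrable (M \<Otimes>\<^sub>M M) (\<lambda>(u, v). g u * (k u v * f v))"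
  proof (rule Fubini_integrable)
    have "(\<lambda>u. T (\<lambda>v. \<bar>f v\<bar>) u * \<bar>g u\<bar>) = (\<lambda>u. \<integral>v. norm (case (u, v) of (u, v) \<Rightarrow> g u * (k u v * f v)) \<partial>M)"
      using kernel_nonneg by (auto simp: T_def abs_mult fun_eq_iff mult.commute)
    then show "integrable M (\<lambda>u. \<integral>v. norm (case (u, v) of (u, v) \<Rightarrow> g u * (k u v * f v)) \<partial>M)"
      using form_integrable[OF L2_abs[OF f] L2_abs[OF g]] by simp
  qed (use column_integrable[OF _ f] in \<open>auto\<close>)
  have "form f g = (\<integral>u. \<integral>v. g u * (k u v * f v) \<partial>M \<partial>M)"
    unfolding form_def T_def by (simp add: mult.commute)
  also have "\<dots> = (\<integral>v. \<integral>u. g u * (k u v * f v) \<partial>M \<partial>M)"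
    using Fubini_integral[OF int] by simp
  also have "\<dots> = (\<integral>v. T g v * f v \<partial>M)"
    unfolding T_def by (subst integral_mult_left_zero[symmetric]) (simp add: kernel_sym mult_ac)
  finally show ?thesis by (simp add: form_def)
qed


lemma form_scale: "form (\<lambda>x. c * f x) (\<lambda>x. c * f x) = c\<^sup>2 * form f f"
proof -
  have "(\<lambda>u. T (\<lambda>x. c * f x) u * (c * f u)) = (\<lambda>u. c\<^sup>2 * (T f u * f u))"
    by (simp add: T_cmult power2_eq_square mult_ac fun_eq_iff)
  then show ?thesis by (simp add: form_def)
qed

text \<open>
Here the sign of the kernel enters: the quadratic form cannot decrease in modulus when \<open>f\<close> is replaced by
its absolute value. Hence \<open>form_sup\<close> bounds the modulus of the form as well, which makes it the norm of
the operator.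
\<close>

lemma form_abs_le:
  assumes f: "f \<in> L2 M"
  shows "\<bar>form f f\<bar> \<le> form (\<lambda>x. \<bar>f x\<bar>) (\<lambda>x. \<bar>f x\<bar>)"
proof -
  have "\<bar>form f f\<bar> \<le> (\<integral>u. \<bar>T f u * f u\<bar> \<partial>M)"
    unfolding form_def by (rule integral_abs_bound)
  also have "\<dots> \<le> form (\<lambda>x. \<bar>f x\<bar>) (\<lambda>x. \<bar>f x\<bar>)"
    unfolding form_def
  proof (rule integral_mono)
    fix u assume u: "u \<in> space M"
    have "\<bar>T f u\<bar> \<le> (\<integral>v. \<bar>k u v * f v\<bar> \<partial>M)"
      unfolding T_def by (rule integral_abs_bound)
    also have "\<dots> = T (\<lambda>x. \<bar>f x\<bar>) u" by (simp add: T_def abs_mult kernel_nonneg)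
    finally show "\<bar>T f u * f u\<bar> \<le> T (\<lambda>x. \<bar>f x\<bar>) u * \<bar>f u\<bar>"
      unfolding abs_mult by (rule mult_right_mono) simp
  qed (intro integrable_abs form_integrable L2_abs f)+
  finally show ?thesis .
qed

lemma form_bdd_above: "bdd_above ((\<lambda>f. form f f) ` {f \<in> L2 M. (\<integral>u. (f u)\<^sup>2 \<partial>M) = 1})"
proof (rule bdd_aboveI2)
  fix f assume "f \<in> {f \<in> L2 M. (\<integral>u. (f u)\<^sup>2 \<partial>M) = 1}"
  then have f: "f \<in> L2 M" and n: "(\<integral>u. (f u)\<^sup>2 \<partial>M) = 1" by auto
  have "form f f \<le> (\<integral>u. C\<^sup>2 + (f u)\<^sup>2 \<partial>M)"
    unfolding form_def
  proof (rule integral_mono[OF form_integrable[OF f f]])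
    show "integrable M (\<lambda>u. C\<^sup>2 + (f u)\<^sup>2)" using L2_square_integrable[OF f] by simp
    fix u assume u: "u \<in> space M"
    have "T f u * f u \<le> (T f u)\<^sup>2 + (f u)\<^sup>2"
      using sum_squares_bound[of "T f u" "f u"] zero_le_power2[of "T f u"] zero_le_power2[of "f u"]
      unfolding mult.assoc by linarith
    with T_square_le[OF u f] n show "T f u * f u \<le> C\<^sup>2 + (f u)\<^sup>2" by simp
  qed
  also have "\<dots> = C\<^sup>2 * measure M (space M) + 1"
    using L2_square_integrable[OF f] n by simp
  finally show "form f f \<le> C\<^sup>2 * measure M (space M) + 1" .
qed

lemma form_le_top:
  assumes f: "f \<in> L2 M"
  shows "form f f \<le> form_sup * (\<integral>u. (f u)\<^sup>2 \<partial>M)"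
proof (cases "(\<integral>u. (f u)\<^sup>2 \<partial>M) = 0")
  case True
  then have "AE u in M. f u = 0"
    using integral_nonneg_eq_0_iff_AE[OF L2_square_integrable[OF f]] by simp
  then have "AE u in M. T f u * f u = 0" by eventually_elim simp
  then have "form f f = 0"
    unfolding form_def by (rule integral_eq_zero_AE)
  with True show ?thesis by simp
next
  case False
  define n where "n = (\<integral>u. (f u)\<^sup>2 \<partial>M)"
  have n: "n > 0" using False by (simp add: n_def less_le)
  define h where "h = (\<lambda>u. (1 / sqrt n) * f u)"
  have "h \<in> L2 M" unfolding h_def by (rule L2_cmult[OF f])
  moreover have "(\<integral>u. (h u)\<^sup>2 \<partial>M) = (1 / sqrt n)\<^sup>2 * n"
    unfolding h_def n_def by (simp add: power_mult_distrib power_divide)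
  then have "(\<integral>u. (h u)\<^sup>2 \<partial>M) = 1" using n by (simp add: power_divide)
  ultimately have "form h h \<le> form_sup"
    unfolding form_sup_def by (intro cSUP_upper form_bdd_above) auto
  moreover have "form h h = form f f / n"
    unfolding h_def form_scale using n by (simp add: power_divide)
  ultimately show ?thesis using n by (simp add: n_def[symmetric] field_simps)
qed

lemma abs_form_le_top:
  "f \<in> L2 M \<Longrightarrow> \<bar>form f f\<bar> \<le> form_sup * (\<integral>u. (f u)\<^sup>2 \<partial>M)"
  using form_abs_le[of f] form_le_top[OF L2_abs, of f] by simp

lemma form_one_pos: "0 < form (\<lambda>_. 1) (\<lambda>_. 1)"
proof -
  have one: "(\<lambda>_. 1) \<in> L2 M" by (rule L2_bounded[where B = 1]) auto
  have T_pos: "0 < T (\<lambda>_. 1) u" if u: "u \<in> space M" for u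
  proof -
    have "0 \<le> T (\<lambda>_. 1) u" by (simp add: T_def kernel_nonneg)
    moreover have "T (\<lambda>_. 1) u \<noteq> 0"
    proof
      assume "T (\<lambda>_. 1) u = 0"
      then have "AE v in M. k u v * 1 = 0"
        unfolding T_def using column_integrable[OF u one]
        by (subst (asm) integral_nonneg_eq_0_iff_AE) (auto simp: kernel_nonneg)
      with kernel_pos[OF u] have "AE v in M. False" by eventually_elim simp
      with space_not_null show False by (simp add: AE_iff_null null_sets_def)
    qed
    ultimately show ?thesis by simp
  qed
  have "0 \<le> form (\<lambda>_. 1) (\<lambda>_. 1)"
    unfolding form_def using T_pos by (intro integral_nonneg_AE) (auto intro: less_imp_le)
  moreover have "form (\<lambda>_. 1) (\<lambda>_. 1) \<noteq> 0"
  proof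
    assume "form (\<lambda>_. 1) (\<lambda>_. 1) = 0"
    then have "AE u in M. T (\<lambda>_. 1) u * 1 = 0"
      unfolding form_def using form_integrable[OF one one] T_pos
      by (subst (asm) integral_nonneg_eq_0_iff_AE) (auto intro: less_imp_le)
    moreover have "AE u in M. 0 < T (\<lambda>_. 1) u" using T_pos by auto
    ultimately have "AE u in M. False" by eventually_elim simp
    with space_not_null show False by (simp add: AE_iff_null null_sets_def)
  qed
  ultimately show ?thesis by simp
qed

text \<open>
The polarization identity, for passing from the quadratic form to the norm of \<open>T f\<close>.
\<close>

lemma form_add_diff:
  assumes f: "f \<in> L2 M" and g: "g \<in> L2 M"
  shows "form (\<lambda>x. f x + g x) (\<lambda>x. f x + g x) - form (\<lambda>x. f x - g x) (\<lambda>x. f x - g x) = 4 * form f g"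
proof -
  note i = form_integrable
  have "form (\<lambda>x. f x + g x) (\<lambda>x. f x + g x) - form (\<lambda>x. f x - g x) (\<lambda>x. f x - g x)
    = (\<integral>u. T (\<lambda>x. f x + g x) u * (f u + g u) - T (\<lambda>x. f x - g x) u * (f u - g u) \<partial>M)"
    unfolding form_def by (intro Bochner_Integration.integral_diff[symmetric] i L2_add L2_diff f g)
  also have "\<dots> = (\<integral>u. 2 * (T f u * g u) + 2 * (T g u * f u) \<partial>M)"
    by (intro Bochner_Integration.integral_cong refl) (simp add: T_add T_diff f g algebra_simps)
  also have "\<dots> = 2 * form f g + 2 * form g f"
    unfolding form_def using i[OF f g] i[OF g f] by simp
  finally show ?thesis using form_sym[OF f g] by simp
qed

text \<open>
Polarization and the parallelogram law bound \<open>form f g\<close> by \<open>form_sup / 2\<close> times the sum of the squared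
norms; the choice of \<open>g\<close> as \<open>T f\<close> divided by \<open>form_sup\<close> balances the two norms and gives the claim.
\<close>

lemma T_norm_le_top:
  assumes f: "f \<in> L2 M" and pos: "0 < form_sup"
  shows "(\<integral>u. (T f u)\<^sup>2 \<partial>M) \<le> form_sup\<^sup>2 * (\<integral>u. (f u)\<^sup>2 \<partial>M)"
proof -
  define a b where "a = (\<integral>u. (f u)\<^sup>2 \<partial>M)" and "b = (\<integral>u. (T f u)\<^sup>2 \<partial>M)"
  define g where "g = (\<lambda>u. (1 / form_sup) * T f u)"
  have g: "g \<in> L2 M" unfolding g_def by (intro L2_cmult T_L2 f)
  have gg: "(\<integral>u. (g u)\<^sup>2 \<partial>M) = b / form_sup\<^sup>2"
    unfolding g_def b_def by (simp add: power_divide)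
  have fg: "form f g = b / form_sup"
    unfolding form_def g_def b_def by (simp add: power2_eq_square)
  have int: "integrable M (\<lambda>u. (f u)\<^sup>2)" "integrable M (\<lambda>u. (g u)\<^sup>2)" "integrable M (\<lambda>u. f u * g u)"
    using f g by (auto intro: L2_square_integrable L2_mult_integrable)
  have "4 * form f g \<le> form_sup * (\<integral>u. (f u + g u)\<^sup>2 \<partial>M) + form_sup * (\<integral>u. (f u - g u)\<^sup>2 \<partial>M)"
    using abs_form_le_top[OF L2_add[OF f g]] abs_form_le_top[OF L2_diff[OF f g]]
    unfolding form_add_diff[OF f g, symmetric] by linarith
  also have "\<dots> = form_sup * ((\<integral>u. (f u)\<^sup>2 + (g u)\<^sup>2 + 2 * (f u * g u) \<partial>M) + (\<integral>u. (f u)\<^sup>2 + (g u)\<^sup>2 - 2 * (f u * g u) \<partial>M))"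
    by (simp add: power2_sum power2_diff distrib_left mult.assoc)
  also have "\<dots> = form_sup * (2 * a + 2 * (b / form_sup\<^sup>2))"
    using int by (simp add: gg[symmetric] a_def)
  finally have "b / form_sup \<le> form_sup * a" using pos fg by (simp add: field_simps power2_eq_square)
  then show ?thesis using pos by (simp add: a_def b_def field_simps power2_eq_square)
qed

lemma eigenvalue_le_top:
  assumes "L2_eigenvalue M T l"
  shows "l \<le> form_sup"
proof -
  obtain f where f: "f \<in> L2 M" and nz: "\<not> (AE u in M. f u = 0)" and eig: "AE u in M. T f u = l * f u"
    using assms unfolding L2_eigenvalue_def by auto
  have [measurable]: "f \<in> borel_measurable M" "T f \<in> borel_measurable M" 
    using f by (auto intro: L2_measurable T_measurable)
  have "form f f = (\<integral>u. l * (f u)\<^sup>2 \<partial>M)"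
    unfolding form_def using eig by (intro integral_cong_AE) (auto simp: power2_eq_square)
  then have "l * (\<integral>u. (f u)\<^sup>2 \<partial>M) \<le> form_sup * (\<integral>u. (f u)\<^sup>2 \<partial>M)"
    using form_le_top[OF f] by simp
  moreover have "(\<integral>u. (f u)\<^sup>2 \<partial>M) \<noteq> 0"
    using nz integral_nonneg_eq_0_iff_AE[OF L2_square_integrable[OF f]] by simp
  then have "0 < (\<integral>u. (f u)\<^sup>2 \<partial>M)" by (simp add: less_le)
  ultimately show ?thesis by simp
qed

end

text \<open>
Countably many columns are dense among all columns. This is the compactness hypothesis: pointwise
convergence on a countable set can be arranged by a diagonal argument, and the density carries it to every point.
\<close>

locale compact_positive_kernel = positive_kernel M k C for M :: "'a measure" and k C +
  fixes D :: "'a set"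
  assumes D_countable: "countable D" and D_subset: "D \<subseteq> space M"
    and D_dense: "u \<in> space M \<Longrightarrow> 0 < e \<Longrightarrow> \<exists>w\<in>D. (\<integral>v. (k u v - k w v)\<^sup>2 \<partial>M) < e"
begin

lemma T_difference_le:
  assumes "u \<in> space M" "w \<in> space M" "f \<in> L2 M"
  shows "(T f u - T f w)\<^sup>2 \<le> (\<integral>v. (k u v - k w v)\<^sup>2 \<partial>M) * (\<integral>v. (f v)\<^sup>2 \<partial>M)"
proof -
  have "T f u - T f w = (\<integral>v. (k u v - k w v) * f v \<partial>M)"
    using assms by (simp add: T_def left_diff_distrib column_integrable)
  then show ?thesis
    using assms by (simp add: L2_Cauchy_Schwarz L2_diff column_L2)
qed

text \<open>
The functions \<open>T (f n)\<close> are uniformly bounded and inherit their modulus of continuity from the columns of the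
kernel, as in the theorem of Arzela and Ascoli.
\<close>

lemma T_pointwise_subsequence:
  assumes f: "\<And>n. f n \<in> L2 M" and n: "\<And>n. (\<integral>u. (f n u)\<^sup>2 \<partial>M) = 1"
  shows "\<exists>r. strict_mono (r :: nat \<Rightarrow> nat) \<and> (\<forall>u\<in>space M. convergent (\<lambda>n. T (f (r n)) u))"
proof -
  have "norm (T (f m) x) \<le> C" if "x \<in> D" for m x
    using T_abs_le[OF _ f, of x m] that D_subset n by auto
  then obtain r where r: "strict_mono (r :: nat \<Rightarrow> nat)"
    and conv: "\<And>x. x \<in> D \<Longrightarrow> \<exists>l. (\<lambda>n. T (f (r n)) x) \<longlonglongrightarrow> l"
    using function_convergent_subsequence[of D "\<lambda>n. T (f n)" C, OF D_countable] by metis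
  have "Cauchy (\<lambda>n. T (f (r n)) u)" if u: "u \<in> space M" for u
  proof (rule metric_CauchyI)
    fix e :: real assume e: "0 < e"
    obtain w where w: "w \<in> D" and small: "(\<integral>v. (k u v - k w v)\<^sup>2 \<partial>M) < (e / 3)\<^sup>2"
      using D_dense[OF u, of "(e / 3)\<^sup>2"] e by auto
    have "Cauchy (\<lambda>n. T (f (r n)) w)"
      using conv[OF w] by (simp add: Cauchy_convergent_iff convergent_def)
    then obtain N where N: "\<And>m n. N \<le> m \<Longrightarrow> N \<le> n \<Longrightarrow> dist (T (f (r m)) w) (T (f (r n)) w) < e / 3"
      using e by (metis metric_CauchyD divide_pos_pos zero_less_numeral)
    have close: "\<bar>T (f i) u - T (f i) w\<bar> < e / 3" for i
    proof -
      have "(T (f i) u - T (f i) w)\<^sup>2 < (e / 3)\<^sup>2"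
        using T_difference_le[OF u _ f, of w i] w D_subset n small by auto
      then show ?thesis using e power2_less_imp_less[of "\<bar>T (f i) u - T (f i) w\<bar>" "e / 3"] by simp
    qed
    show "\<exists>N. \<forall>m\<ge>N. \<forall>n\<ge>N. dist (T (f (r m)) u) (T (f (r n)) u) < e"
    proof (intro exI[of _ N] allI impI)
      fix m n assume "N \<le> m" "N \<le> n"
      from N[OF this] close[of "r m"] close[of "r n"]
      show "dist (T (f (r m)) u) (T (f (r n)) u) < e"
        unfolding dist_real_def by linarith
    qed
  qed
  with r show ?thesis
    by (intro exI[of _ r] conjI ballI) (simp_all add: Cauchy_convergent_iff)
qed

end

context positive_kernel
begin

lemma one_L2: "(\<lambda>_. 1) \<in> L2 M"
  by (rule L2_bounded[where B = 1]) auto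

lemma top_pos: "0 < form_sup"
proof -
  have "0 < form_sup * measure M (space M)"
    using form_one_pos form_le_top[OF one_L2] by simp
  then show ?thesis
    using measure_nonneg[of M "space M"] by (auto simp: zero_less_mult_iff)
qed

lemma unit_functions_nonempty: "{f \<in> L2 M. (\<integral>u. (f u)\<^sup>2 \<partial>M) = 1} \<noteq> {}"
proof -
  define m where "m = measure M (space M)"
  have m: "0 < m"
    using space_not_null measure_nonneg[of M "space M"] unfolding m_def emeasure_eq_measure
    by (auto simp: less_le)
  have "(\<lambda>_. (1 / sqrt m) * 1) \<in> L2 M" by (rule L2_cmult[OF one_L2])
  moreover have "(\<integral>u. ((1 / sqrt m) * 1)\<^sup>2 \<partial>M) = 1"
    using m by (simp add: power_divide m_def[symmetric])
  ultimately show ?thesis by blast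
qed

lemma top_leI: "(\<And>f. f \<in> L2 M \<Longrightarrow> (\<integral>u. (f u)\<^sup>2 \<partial>M) = 1 \<Longrightarrow> form f f \<le> B) \<Longrightarrow> form_sup \<le> B"
  unfolding form_sup_def by (rule cSUP_least[OF unit_functions_nonempty]) auto

lemma maximizing_sequence:
  "\<exists>f. (\<forall>n::nat. f n \<in> L2 M) \<and> (\<forall>n. (\<integral>u. (f n u)\<^sup>2 \<partial>M) = 1) \<and>
    (\<lambda>n. form (f n) (f n)) \<longlonglongrightarrow> form_sup"
proof -
  have "\<exists>f. f \<in> L2 M \<and> (\<integral>u. (f u)\<^sup>2 \<partial>M) = 1 \<and> form_sup - 1 / Suc n < form f f" for n
  proof (rule ccontr)
    assume "\<not> ?thesis"
    then have "form_sup \<le> form_sup - 1 / Suc n" by (intro top_leI) (auto simp: not_less)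
    then show False by simp
  qed
  then obtain f where f: "\<And>n. f n \<in> L2 M" "\<And>n. (\<integral>u. (f n u)\<^sup>2 \<partial>M) = 1"
    and low: "\<And>n. form_sup - 1 / Suc n < form (f n) (f n)" by metis
  have up: "form (f n) (f n) \<le> form_sup" for n using form_le_top[OF f(1), of n] f(2)[of n] by simp
  have "(\<lambda>n. form_sup - 1 / Suc n) \<longlonglongrightarrow> form_sup - 0"
    by (intro tendsto_diff tendsto_const LIMSEQ_Suc[OF lim_1_over_n])
  then have lim: "(\<lambda>n. form_sup - 1 / Suc n) \<longlonglongrightarrow> form_sup" by simp
  have "(\<lambda>n. form (f n) (f n)) \<longlonglongrightarrow> form_sup"
  proof (rule tendsto_sandwich[OF _ _ lim tendsto_const])
    show "\<forall>\<^sub>F n in sequentially. form_sup - 1 / Suc n \<le> form (f n) (f n)"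
      using low by (simp add: less_imp_le)
    show "\<forall>\<^sub>F n in sequentially. form (f n) (f n) \<le> form_sup"
      using up by simp
  qed
  with f show ?thesis by (intro exI[of _ f] conjI allI)
qed

text \<open>
For unit vectors, \<open>\<integral>(T f - form_sup * f)\<^sup>2\<close> expands to \<open>\<integral>(T f)\<^sup>2 - 2 * form_sup * form f f + form_sup\<^sup>2\<close>, and the
first term is at most \<open>form_sup\<^sup>2\<close>.
\<close>

lemma approximate_eigenfunctions:
  assumes f: "\<And>n::nat. f n \<in> L2 M" and n: "\<And>n. (\<integral>u. (f n u)\<^sup>2 \<partial>M) = 1"
    and lim: "(\<lambda>n. form (f n) (f n)) \<longlonglongrightarrow> form_sup"
  shows "(\<lambda>n. \<integral>u. (T (f n) u - form_sup * f n u)\<^sup>2 \<partial>M) \<longlonglongrightarrow> 0"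
proof (rule tendsto_sandwich[where f = "\<lambda>_. 0"])
  have "(\<lambda>n. 2 * form_sup * (form_sup - form (f n) (f n))) \<longlonglongrightarrow> 2 * form_sup * (form_sup - form_sup)"
    by (intro tendsto_intros lim)
  then show "(\<lambda>n. 2 * form_sup * (form_sup - form (f n) (f n))) \<longlonglongrightarrow> 0" by simp
  show "\<forall>\<^sub>F n in sequentially. (\<integral>u. (T (f n) u - form_sup * f n u)\<^sup>2 \<partial>M) \<le> 2 * form_sup * (form_sup - form (f n) (f n))"
  proof (intro always_eventually allI)
    fix m
    have i: "integrable M (\<lambda>u. (T (f m) u)\<^sup>2)" "integrable M (\<lambda>u. (f m u)\<^sup>2)"
       "integrable M (\<lambda>u. T (f m) u * f m u)"
      using f by (auto intro: L2_square_integrable T_L2 form_integrable)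
    have "(\<integral>u. (T (f m) u - form_sup * f m u)\<^sup>2 \<partial>M)
      = (\<integral>u. (T (f m) u)\<^sup>2 - (2 * form_sup) * (T (f m) u * f m u) + form_sup\<^sup>2 * (f m u)\<^sup>2 \<partial>M)"
      by (intro Bochner_Integration.integral_cong refl)
        (simp add: power2_diff power_mult_distrib)
    also have "\<dots> = (\<integral>u. (T (f m) u)\<^sup>2 \<partial>M) - 2 * form_sup * form (f m) (f m) + form_sup\<^sup>2"
      using i n[of m] by (simp add: form_def)
    also have "\<dots> \<le> form_sup\<^sup>2 - 2 * form_sup * form (f m) (f m) + form_sup\<^sup>2"
      using T_norm_le_top[OF f top_pos, of m] n[of m] by simp
    finally show "(\<integral>u. (T (f m) u - form_sup * f m u)\<^sup>2 \<partial>M) \<le> 2 * form_sup * (form_sup - form (f m) (f m))"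
      by (simp add: power2_eq_square algebra_simps)
  qed
qed auto

end

lemma L2_triangle_square:
  assumes f: "f \<in> L2 M" and g: "g \<in> L2 M"
  shows "(\<integral>x. (f x + g x)\<^sup>2 \<partial>M) \<le> 2 * (\<integral>x. (f x)\<^sup>2 \<partial>M) + 2 * (\<integral>x. (g x)\<^sup>2 \<partial>M)"
proof -
  have "(\<integral>x. (f x + g x)\<^sup>2 \<partial>M) \<le> (\<integral>x. 2 * (f x)\<^sup>2 + 2 * (g x)\<^sup>2 \<partial>M)"
  proof (rule integral_mono)
    show "integrable M (\<lambda>x. (f x + g x)\<^sup>2)"
      by (rule L2_square_integrable[OF L2_add[OF f g]])
    show "integrable M (\<lambda>x. 2 * (f x)\<^sup>2 + 2 * (g x)\<^sup>2)"
      using L2_square_integrable[OF f] L2_square_integrable[OF g] by simp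
    fix x
    have "0 \<le> (f x - g x)\<^sup>2" by simp
    then show "(f x + g x)\<^sup>2 \<le> 2 * (f x)\<^sup>2 + 2 * (g x)\<^sup>2"
      by (simp add: power2_sum power2_diff)
  qed
  also have "\<dots> = 2 * (\<integral>x. (f x)\<^sup>2 \<partial>M) + 2 * (\<integral>x. (g x)\<^sup>2 \<partial>M)"
    using L2_square_integrable[OF f] L2_square_integrable[OF g] by simp
  finally show ?thesis .
qed

lemma L2_tendsto_triangle:
  fixes f g h :: "nat \<Rightarrow> 'a \<Rightarrow> real"
  assumes f: "\<And>n. f n \<in> L2 M" and g: "\<And>n. g n \<in> L2 M" and h: "\<And>n. h n \<in> L2 M"
    and fg: "(\<lambda>n. \<integral>x. (f n x - g n x)\<^sup>2 \<partial>M) \<longlonglongrightarrow> 0"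
    and gh: "(\<lambda>n. \<integral>x. (g n x - h n x)\<^sup>2 \<partial>M) \<longlonglongrightarrow> 0"
  shows "(\<lambda>n. \<integral>x. (f n x - h n x)\<^sup>2 \<partial>M) \<longlonglongrightarrow> 0"
proof (rule tendsto_sandwich[where f = "\<lambda>_. 0"])
  show "(\<lambda>n. 2 * (\<integral>x. (f n x - g n x)\<^sup>2 \<partial>M) + 2 * (\<integral>x. (g n x - h n x)\<^sup>2 \<partial>M)) \<longlonglongrightarrow> 0"
    using tendsto_add[OF tendsto_mult_left[OF fg, of 2] tendsto_mult_left[OF gh, of 2]] by simp
  show "\<forall>\<^sub>F n in sequentially. (\<integral>x. (f n x - h n x)\<^sup>2 \<partial>M)
      \<le> 2 * (\<integral>x. (f n x - g n x)\<^sup>2 \<partial>M) + 2 * (\<integral>x. (g n x - h n x)\<^sup>2 \<partial>M)"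
  proof (rule always_eventually, rule allI)
    fix n
    show "(\<integral>x. (f n x - h n x)\<^sup>2 \<partial>M)
      \<le> 2 * (\<integral>x. (f n x - g n x)\<^sup>2 \<partial>M) + 2 * (\<integral>x. (g n x - h n x)\<^sup>2 \<partial>M)"
      using L2_triangle_square[OF L2_diff[OF f[of n] g[of n]] L2_diff[OF g[of n] h[of n]]] by simp
  qed
qed simp_all

context compact_positive_kernel
begin

text \<open>
Along the subsequence, \<open>T (h n)\<close> converges pointwise and boundedly, hence in \<open>L\<^sup>2\<close>, to some \<open>g\<close>. As
\<open>form_sup * h n\<close> differs from \<open>T (h n)\<close> by a null sequence in \<open>L\<^sup>2\<close>, it tends to \<open>g\<close> too. Applying \<open>T\<close> once
more gives \<open>T g = form_sup * g\<close>, and \<open>g\<close> does not vanish since the \<open>h n\<close> have norm one.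
\<close>

theorem top_eigenvalue: "L2_eigenvalue M T form_sup"
proof -
  obtain f where f_props: "(\<forall>n::nat. f n \<in> L2 M) \<and> (\<forall>n. (\<integral>u. (f n u)\<^sup>2 \<partial>M) = 1) \<and>
      (\<lambda>n. form (f n) (f n)) \<longlonglongrightarrow> form_sup"
    using maximizing_sequence by (rule exE)
  then have f: "\<And>n. f n \<in> L2 M" and n: "\<And>n. (\<integral>u. (f n u)\<^sup>2 \<partial>M) = 1"
    and max: "(\<lambda>n. form (f n) (f n)) \<longlonglongrightarrow> form_sup" by simp_all
  obtain r where "strict_mono (r :: nat \<Rightarrow> nat) \<and> (\<forall>u\<in>space M. convergent (\<lambda>n. T (f (r n)) u))"
    using T_pointwise_subsequence[of f, OF f n] by (rule exE)
  then have r: "strict_mono r" and conv: "\<And>u. u \<in> space M \<Longrightarrow> convergent (\<lambda>n. T (f (r n)) u)"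
    by auto
  define h where "h = (\<lambda>n. f (r n))"
  have h: "h n \<in> L2 M" and hn: "(\<integral>u. (h n u)\<^sup>2 \<partial>M) = 1" for n
    by (simp_all add: h_def f n)
  have hmax: "(\<lambda>n. form (h n) (h n)) \<longlonglongrightarrow> form_sup"
    using LIMSEQ_subseq_LIMSEQ[OF max r] by (simp add: h_def o_def)
  define g where "g = (\<lambda>u. lim (\<lambda>n. T (h n) u))"
  have g: "(\<lambda>n. T (h n) u) \<longlonglongrightarrow> g u" if "u \<in> space M" for u
    using conv[OF that] by (simp add: g_def h_def convergent_LIMSEQ_iff)
  have [measurable]: "T (h n) \<in> borel_measurable M" for n by (intro T_measurable h)
  have [measurable]: "g \<in> borel_measurable M"
    by (rule borel_measurable_LIMSEQ_real[OF g]) simp_all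
  have Th_le: "\<bar>T (h n) u\<bar> \<le> C" if "u \<in> space M" for u n
    using T_abs_le[OF that h] hn by simp
  have g_le: "\<bar>g u\<bar> \<le> C" if "u \<in> space M" for u
    using tendsto_rabs[OF g[OF that]] Th_le[OF that] by (intro LIMSEQ_le_const2) auto
  have gL2: "g \<in> L2 M" by (rule L2_bounded[OF _ g_le]) simp
  have Th_g: "(\<lambda>n. \<integral>u. (T (h n) u - g u)\<^sup>2 \<partial>M) \<longlonglongrightarrow> 0"
  proof -
    have "(\<lambda>n. \<integral>u. (T (h n) u - g u)\<^sup>2 \<partial>M) \<longlonglongrightarrow> (\<integral>u. 0 \<partial>M)"
    proof (rule integral_dominated_convergence[where w = "\<lambda>_. (2 * C)\<^sup>2"])
      show "AE u in M. (\<lambda>n. (T (h n) u - g u)\<^sup>2) \<longlonglongrightarrow> 0"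
      proof (rule AE_I2)
        fix u assume "u \<in> space M"
        from tendsto_power[OF tendsto_diff[OF g[OF this] tendsto_const[of "g u"]], of 2]
        show "(\<lambda>n. (T (h n) u - g u)\<^sup>2) \<longlonglongrightarrow> 0" by simp
      qed
      show "AE u in M. norm ((T (h n) u - g u)\<^sup>2) \<le> (2 * C)\<^sup>2" for n
      proof (rule AE_I2)
        fix u assume u: "u \<in> space M"
        have "\<bar>T (h n) u - g u\<bar> \<le> \<bar>2 * C\<bar>" using Th_le[OF u, of n] g_le[OF u] by linarith
        then show "norm ((T (h n) u - g u)\<^sup>2) \<le> (2 * C)\<^sup>2"
          by (simp only: abs_le_square_iff real_norm_def abs_power2)
      qed
    qed auto
    then show ?thesis by simp
  qed
  have "(\<lambda>n. \<integral>u. (form_sup * h n u - T (h n) u)\<^sup>2 \<partial>M) \<longlonglongrightarrow> 0"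
    using approximate_eigenfunctions[of h, OF h hn hmax] by (simp add: power2_commute)
  from L2_tendsto_triangle[where f = "\<lambda>n u. form_sup * h n u" and g = "\<lambda>n. T (h n)" and h = "\<lambda>_. g",
      OF L2_cmult[OF h] T_L2[OF h] gL2 this Th_g]
  have hg: "(\<lambda>n. \<integral>u. (form_sup * h n u - g u)\<^sup>2 \<partial>M) \<longlonglongrightarrow> 0" .
  have "T g u = form_sup * g u" if u: "u \<in> space M" for u
  proof (rule LIMSEQ_unique)
    show "(\<lambda>n. form_sup * T (h n) u) \<longlonglongrightarrow> form_sup * g u" by (intro tendsto_mult_left g u)
    have "(\<lambda>n. form_sup * T (h n) u - T g u) \<longlonglongrightarrow> 0"
    proof (rule Lim_null_comparison)
      have "(\<lambda>n. C * sqrt (\<integral>u. (form_sup * h n u - g u)\<^sup>2 \<partial>M)) \<longlonglongrightarrow> C * sqrt 0"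
        by (intro tendsto_mult_left tendsto_real_sqrt hg)
      then show "(\<lambda>n. C * sqrt (\<integral>u. (form_sup * h n u - g u)\<^sup>2 \<partial>M)) \<longlonglongrightarrow> 0" by simp
      show "\<forall>\<^sub>F n in sequentially. norm (form_sup * T (h n) u - T g u) \<le> C * sqrt (\<integral>u. (form_sup * h n u - g u)\<^sup>2 \<partial>M)"
      proof (intro always_eventually allI)
        fix n
        show "norm (form_sup * T (h n) u - T g u) \<le> C * sqrt (\<integral>u. (form_sup * h n u - g u)\<^sup>2 \<partial>M)"
          using T_abs_le[OF u L2_diff[OF L2_cmult[OF h[of n], of form_sup] gL2]]
          by (simp add: T_diff[OF u L2_cmult[OF h] gL2] T_cmult)
      qed
    qed
    then show "(\<lambda>n. form_sup * T (h n) u) \<longlonglongrightarrow> T g u" by (simp add: LIM_zero_iff)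
  qed
  moreover have "\<not> (AE u in M. g u = 0)"
  proof
    assume g0: "AE u in M. g u = 0"
    have "(\<integral>u. (form_sup * h n u - g u)\<^sup>2 \<partial>M) = form_sup\<^sup>2" for n
    proof -
      have [measurable]: "h n \<in> borel_measurable M" by (rule L2_measurable[OF h])
      have "(\<integral>u. (form_sup * h n u - g u)\<^sup>2 \<partial>M) = (\<integral>u. form_sup\<^sup>2 * (h n u)\<^sup>2 \<partial>M)"
        using g0 by (intro integral_cong_AE) (auto simp: power_mult_distrib)
      then show ?thesis using hn[of n] by simp
    qed
    with hg have "form_sup\<^sup>2 = 0" by (simp add: LIMSEQ_const_iff)
    with top_pos show False by simp
  qed
  ultimately show ?thesis using gL2 unfolding L2_eigenvalue_def by auto
qed

theorem lambda_max_eq_top: "lambda_max M T = form_sup"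
  unfolding lambda_max_def by (rule Greatest_equality, rule top_eigenvalue, rule eigenvalue_le_top)

end

text \<open>
A perturbation of rank one by \<open>c * p u * p v\<close> adds \<open>c * (\<integral>p * f)\<^sup>2\<close> to the form, which the
Cauchy--Schwarz inequality bounds by \<open>c * \<integral>p\<^sup>2\<close>. The case \<open>c = 0\<close> is the monotonicity of the
largest eigenvalue in the kernel.
\<close>

lemma top_le_perturbation:
  assumes "positive_kernel M k C" "positive_kernel M k' C'"
    and p: "p \<in> L2 M" and c: "0 \<le> c"
    and le: "\<And>u v. u \<in> space M \<Longrightarrow> v \<in> space M \<Longrightarrow> k u v \<le> k' u v + c * (p u * p v)"
  shows "positive_kernel.form_sup M k \<le> positive_kernel.form_sup M k' + c * (\<integral>u. (p u)\<^sup>2 \<partial>M)"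
proof -
  interpret K: positive_kernel M k C by fact
  interpret K': positive_kernel M k' C' by fact
  show ?thesis
  proof (rule K.top_leI)
    fix f assume f: "f \<in> L2 M" and n: "(\<integral>u. (f u)\<^sup>2 \<partial>M) = 1"
    define g where "g = (\<lambda>x. \<bar>f x\<bar>)"
    have g: "g \<in> L2 M" and gn: "(\<integral>u. (g u)\<^sup>2 \<partial>M) = 1" and g0: "\<And>u. 0 \<le> g u"
      using f n by (simp_all add: g_def L2_abs)
    define s where "s = (\<integral>v. p v * g v \<partial>M)"
    have "K.form f f \<le> K.form g g" using K.form_abs_le[OF f] by (simp add: g_def)
    also have "\<dots> \<le> (\<integral>u. K'.T g u * g u + c * s * (p u * g u) \<partial>M)"
      unfolding K.form_def
    proof (rule integral_mono)
      fix u assume u: "u \<in> space M"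
      have "K.T g u \<le> (\<integral>v. k' u v * g v + c * p u * (p v * g v) \<partial>M)"
        unfolding K.T_def
      proof (rule integral_mono)
        fix v assume v: "v \<in> space M"
        show "k u v * g v \<le> k' u v * g v + c * p u * (p v * g v)"
          using mult_right_mono[OF le[OF u v] g0[of v]] by (simp add: algebra_simps)
      qed (intro K.column_integrable K'.column_integrable u g Bochner_Integration.integrable_add
          integrable_mult_right L2_mult_integrable p)+
      also have "\<dots> = K'.T g u + c * p u * s"
        using K'.column_integrable[OF u g] L2_mult_integrable[OF p g] by (simp add: K'.T_def s_def)
      finally show "K.T g u * g u \<le> K'.T g u * g u + c * s * (p u * g u)"
        using mult_right_mono[OF _ g0[of u], of "K.T g u" "K'.T g u + c * p u * s"] by (simp add: algebra_simps)
    qed (intro K.form_integrable K'.form_integrable g Bochner_Integration.integrable_add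
          integrable_mult_right L2_mult_integrable p)+
    also have "\<dots> = K'.form g g + c * s\<^sup>2"
      using K'.form_integrable[OF g g] L2_mult_integrable[OF p g]
      by (simp add: K'.form_def s_def power2_eq_square)
    also have "\<dots> \<le> K'.form_sup + c * (\<integral>u. (p u)\<^sup>2 \<partial>M)"
      using K'.form_le_top[OF g] gn L2_Cauchy_Schwarz[OF p g] c
      by (intro add_mono mult_left_mono) (auto simp: s_def)
    finally show "K.form f f \<le> K'.form_sup + c * (\<integral>u. (p u)\<^sup>2 \<partial>M)" .
  qed
qed

section \<open>The exponential measure\<close>

lemma space_nu [simp]: "space nu = {0..}"
  by (simp add: nu_def space_restrict_space)

lemma sets_nu [measurable_cong]: "sets nu = sets (restrict_space borel {0..})"
  by (simp add: nu_def sets_restrict_space)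

lemma measurable_nu_borel:
  assumes "f \<in> borel_measurable borel"
  shows "f \<in> borel_measurable nu"
  using measurable_restrict_space1[OF assms, of "{0..}"]
  by (simp cong: measurable_cong_sets add: sets_nu)

lemma measurable_ident_nu: "(\<lambda>x. x) \<in> borel_measurable nu"
  by (rule measurable_nu_borel) simp

lemma nn_integral_nu:
  assumes "f \<in> borel_measurable nu"
  shows "(\<integral>\<^sup>+x. f x \<partial>nu) = (\<integral>\<^sup>+x. ennreal (exp (- x)) * f x * indicator {0..} x \<partial>lborel)"
proof -
  have "f \<in> borel_measurable (restrict_space lborel {0..})"
    using assms by (simp add: nu_def)
  then show ?thesis
    unfolding nu_def
    by (subst nn_integral_density) (auto simp: nn_integral_restrict_space measurable_restrict_space1)
qed

lemma integral_nu:
  fixes f :: "real \<Rightarrow> real"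
  assumes "f \<in> borel_measurable nu"
  shows "(\<integral>x. f x \<partial>nu) = (\<integral>x. indicator {0..} x * (exp (- x) * f x) \<partial>lborel)"
proof -
  have "f \<in> borel_measurable (restrict_space lborel {0..})"
    using assms by (simp add: nu_def)
  then show ?thesis
    unfolding nu_def
    by (subst integral_density) (auto simp: integral_restrict_space measurable_restrict_space1)
qed

lemma integrable_nu:
  fixes f :: "real \<Rightarrow> real"
  assumes "f \<in> borel_measurable nu"
  shows "integrable nu f \<longleftrightarrow> integrable lborel (\<lambda>x. indicator {0..} x * (exp (- x) * f x))"
proof -
  have "f \<in> borel_measurable (restrict_space lborel {0..})"
    using assms by (simp add: nu_def)
  then show ?thesis
    unfolding nu_def
    by (subst integrable_density) (auto simp: integrable_restrict_space measurable_restrict_space1)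
qed

lemma AE_nu: "(AE x in nu. P x) \<longleftrightarrow> (AE x in lborel. 0 \<le> x \<longrightarrow> P x)"
  unfolding nu_def
  by (subst AE_density) (auto simp: AE_restrict_space_iff measurable_restrict_space1)

lemma AE_nu_neq: "AE x in nu. x \<noteq> c"
  unfolding AE_nu using AE_lborel_singleton[of c] by eventually_elim simp

lemma nn_integral_nu_power: "(\<integral>\<^sup>+x. ennreal (x ^ n) \<partial>nu) = ennreal (fact n)"
proof -
  have "(\<integral>\<^sup>+x. ennreal (x ^ n) \<partial>nu)
    = (\<integral>\<^sup>+x. ennreal (x ^ n * exp (- x)) * indicator {0..} x \<partial>lborel)"
    by (subst nn_integral_nu)
      (auto intro!: nn_integral_cong measurable_nu_borel simp: ennreal_mult'' mult.commute split: split_indicator)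
  then show ?thesis by (simp add: nn_intergal_power_times_exp_Ici)
qed

interpretation nu: prob_space nu
proof
  show "emeasure nu (space nu) = 1"
    using nn_integral_nu_power[of 0] by simp
qed

lemma integrable_nu_power: "integrable nu (\<lambda>x. x ^ n)"
proof -
  have "(\<integral>\<^sup>+x. ennreal (norm (x ^ n)) \<partial>nu) = (\<integral>\<^sup>+x. ennreal (x ^ n) \<partial>nu)"
    by (intro nn_integral_cong) (simp add: power_abs)
  then show ?thesis
    by (simp add: integrable_iff_bounded measurable_nu_borel nn_integral_nu_power)
qed

lemma one_plus_square_L2: "(\<lambda>u. 1 + u\<^sup>2) \<in> L2 nu"
proof -
  have "integrable nu (\<lambda>u::real. 1 + 2 * u\<^sup>2 + u ^ 4)"
    by (intro Bochner_Integration.integrable_add integrable_mult_right integrable_nu_power) simp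
  then show ?thesis
    by (simp add: L2_def measurable_nu_borel power2_sum power_mult[symmetric] add_ac mult_ac)
qed

text \<open>
The density of the exponential measure is at most one, so integrals of translates are bounded by the
translation-invariant Lebesgue integral. This makes the estimates below uniform in the point \<open>w\<close>.
\<close>

lemma nu_reflected_translate:
  fixes R :: "real \<Rightarrow> real"
  assumes R: "integrable lborel R" and R0: "\<And>t. 0 \<le> R t"
  shows "integrable nu (\<lambda>v. R (w - v))" and "(\<integral>v. R (w - v) \<partial>nu) \<le> (\<integral>t. R t \<partial>lborel)"
proof -
  have [measurable]: "R \<in> borel_measurable borel"
    using borel_measurable_integrable[OF R] by simp
  have Rw: "(\<lambda>v. R (w - v)) \<in> borel_measurable nu"
    by (rule measurable_nu_borel) simp
  have int: "integrable lborel (\<lambda>v. R (w - v))"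
    using lborel_integrable_real_affine[OF R, of "-1" w] by simp
  have le: "norm (indicator {0..} v * (exp (- v) * R (w - v))) \<le> R (w - v)" for v
    using R0[of "w - v"] mult_right_mono[of "exp (- v)" 1 "R (w - v)"]
    by (auto split: split_indicator simp: abs_mult)
  have int': "integrable lborel (\<lambda>v. indicator {0..} v * (exp (- v) * R (w - v)))"
  proof (rule Bochner_Integration.integrable_bound[OF int])
    show "AE v in lborel. norm (indicator {0..} v * (exp (- v) * R (w - v))) \<le> norm (R (w - v))"
      using le R0 by (intro AE_I2) simp
  qed measurable
  then show "integrable nu (\<lambda>v. R (w - v))" by (simp add: integrable_nu[OF Rw])
  have "(\<integral>v. R (w - v) \<partial>nu) = (\<integral>v. indicator {0..} v * (exp (- v) * R (w - v)) \<partial>lborel)"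
    by (rule integral_nu[OF Rw])
  also have "\<dots> \<le> (\<integral>v. R (w - v) \<partial>lborel)"
    using le by (intro integral_mono int int') (auto simp: abs_le_iff)
  also have "\<dots> = (\<integral>t. R t \<partial>lborel)"
    using lborel_integral_real_affine[of "-1" R w] by simp
  finally show "(\<integral>v. R (w - v) \<partial>nu) \<le> (\<integral>t. R t \<partial>lborel)" .
qed

lemma integrable_abs_powr_near_0:
  assumes "-1 < a"
  shows "integrable lborel (\<lambda>t::real. indicator {-1..1} t * \<bar>t\<bar> powr a)"
proof -
  let ?h = "\<lambda>t::real. indicator {0..1} t * t powr a"
  have "(\<lambda>t. t powr a) absolutely_integrable_on {0..1}"
    using integrable_on_powr_from_0[OF assms, of 1] by (subst absolutely_integrable_on_iff_nonneg) auto
  then have h: "integrable lborel ?h"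
    unfolding set_integrable_def by (subst (asm) integrable_completion) auto
  have "integrable lborel (\<lambda>t. ?h t + ?h (0 + (-1) * t))"
    by (intro Bochner_Integration.integrable_add h lborel_integrable_real_affine[OF h]) simp
  then show ?thesis
    by (rule Bochner_Integration.integrable_bound) (auto split: split_indicator)
qed

section \<open>Difference kernels with a mild singularity\<close>

lemma nonneg_rational_sequence:
  fixes u :: real
  assumes "0 \<le> u"
  shows "\<exists>w. (\<forall>i. w i \<in> \<rat> \<inter> {0..}) \<and> w \<longlonglongrightarrow> u"
proof -
  have "\<exists>r\<in>\<rat>. u < r \<and> r < u + 1 / Suc i" for i
    by (intro Rats_dense_in_real) simp
  then obtain w where w: "\<And>i. w i \<in> \<rat>" "\<And>i. u < w i" "\<And>i. w i < u + 1 / Suc i" by metis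
  have "(\<lambda>i. u + 1 / Suc i) \<longlonglongrightarrow> u + 0"
    by (intro tendsto_add tendsto_const LIMSEQ_Suc[OF lim_1_over_n])
  then have up: "(\<lambda>i. u + 1 / Suc i) \<longlonglongrightarrow> u" by simp
  have "w \<longlonglongrightarrow> u"
    by (rule tendsto_sandwich[OF _ _ tendsto_const up]) (use w in \<open>simp_all add: less_imp_le\<close>)
  moreover have "\<forall>i. w i \<in> \<rat> \<inter> {0..}"
    using w assms by (auto intro: less_imp_le order.strict_trans1)
  ultimately show ?thesis by blast
qed

text \<open>
Kernels of the form \<open>g \<bar>u - v\<bar>\<close> with a singularity of order less than one half on the diagonal. The value
\<open>g 0 = 0\<close> matches the convention that powers of zero are zero.
\<close>

locale singular_profile =
  fixes \<alpha> :: real and g :: "real \<Rightarrow> real"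
  assumes \<alpha>_pos: "0 < \<alpha>" and \<alpha>_less: "\<alpha> < 1 / 2"
    and g_measurable [measurable]: "g \<in> borel_measurable borel"
    and g_cont: "\<And>t. 0 < t \<Longrightarrow> isCont g t"
    and g_pos: "\<And>t. 0 < t \<Longrightarrow> 0 < g t"
    and g_le: "\<And>t. 0 < t \<Longrightarrow> g t \<le> t powr - \<alpha>"
    and g_0: "g 0 = 0"
begin

definition k :: "real \<Rightarrow> real \<Rightarrow> real" where
  "k u v = g \<bar>u - v\<bar>"

definition C :: real where
  "C = sqrt (1 + (\<integral>t. indicator {-1..1} t * \<bar>t\<bar> powr (- 2 * \<alpha>) \<partial>lborel))"

text \<open>
The squared excess of the singularity over the level \<open>n + 1\<close>. At levels of at least one it lives on the
interval from -1 to 1, where the square of the singularity is integrable.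
\<close>

definition tail :: "nat \<Rightarrow> real \<Rightarrow> real" where
  "tail n t = (max 0 (\<bar>t\<bar> powr - \<alpha> - Suc n))\<^sup>2"

lemma k_nonneg: "0 \<le> k u v"
  unfolding k_def using g_pos[of "\<bar>u - v\<bar>"] g_0 by (cases "u = v") auto

lemma k_le: "k u v \<le> \<bar>u - v\<bar> powr - \<alpha>"
  unfolding k_def using g_le[of "\<bar>u - v\<bar>"] g_0 by (cases "u = v") auto

lemma singularity_integrable:
  "integrable lborel (\<lambda>t::real. indicator {-1..1} t * \<bar>t\<bar> powr (- 2 * \<alpha>))"
  by (rule integrable_abs_powr_near_0) (use \<alpha>_less in simp)

lemma powr_square: "(x powr - \<alpha>)\<^sup>2 = x powr (- 2 * \<alpha>)" if "0 \<le> x"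
  using that by (cases "x = 0") (simp_all add: powr_realpow[symmetric] powr_powr mult.commute)

lemma powr_le_1: "1 \<le> x \<Longrightarrow> x powr - \<alpha> \<le> 1"
  using \<alpha>_pos powr_mono2'[of "-\<alpha>" 1 x] by simp

lemma k_column_measurable [measurable]: "k u \<in> borel_measurable nu"
  unfolding k_def by (rule measurable_nu_borel) simp

lemma k_square_le: "(k u v)\<^sup>2 \<le> 1 + indicator {-1..1} (u - v) * \<bar>u - v\<bar> powr (- 2 * \<alpha>)"
proof (cases "\<bar>u - v\<bar> \<le> 1")
  case True
  have "(k u v)\<^sup>2 \<le> (\<bar>u - v\<bar> powr - \<alpha>)\<^sup>2"
    by (intro power_mono k_le k_nonneg)
  then show ?thesis using True by (simp add: powr_square indicator_def abs_le_iff)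
next
  case False
  have "(k u v)\<^sup>2 \<le> 1\<^sup>2"
    by (intro power_mono order.trans[OF k_le powr_le_1] k_nonneg) (use False in simp)
  also have "1\<^sup>2 \<le> 1 + indicator {-1..1} (u - v) * \<bar>u - v\<bar> powr (- 2 * \<alpha>)" by simp
  finally show ?thesis .
qed

lemma k_column: "k u \<in> L2 nu" "(\<integral>v. (k u v)\<^sup>2 \<partial>nu) \<le> C\<^sup>2"
proof -
  define R :: "real \<Rightarrow> real" where "R = (\<lambda>t. indicator {-1..1} t * \<bar>t\<bar> powr (- 2 * \<alpha>))"
  have R: "integrable lborel R" "\<And>t. 0 \<le> R t"
    using singularity_integrable by (auto simp: R_def)
  note Ru = nu_reflected_translate[OF R, of u]
  have int: "integrable nu (\<lambda>v. 1 + R (u - v))" using Ru by simp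
  have sq: "integrable nu (\<lambda>v. (k u v)\<^sup>2)"
  proof (rule Bochner_Integration.integrable_bound[OF int])
    show "AE v in nu. norm ((k u v)\<^sup>2) \<le> norm (1 + R (u - v))"
      using k_square_le[of u] R(2) by (intro AE_I2) (auto simp: R_def intro: order.trans)
  qed measurable
  then show "k u \<in> L2 nu" by (simp add: L2_def)
  have "(\<integral>v. (k u v)\<^sup>2 \<partial>nu) \<le> (\<integral>v. 1 + R (u - v) \<partial>nu)"
    using k_square_le[of u] by (intro integral_mono sq int) (simp add: R_def)
  also have "\<dots> \<le> 1 + (\<integral>t. R t \<partial>lborel)"
    using Ru nu.prob_space by simp
  also have "\<dots> = C\<^sup>2"
    using integral_nonneg_AE[of R lborel] R(2) by (simp add: C_def R_def)
  finally show "(\<integral>v. (k u v)\<^sup>2 \<partial>nu) \<le> C\<^sup>2" .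
qed

sublocale positive_kernel nu k C
proof
  show "(\<lambda>(u, v). k u v) \<in> borel_measurable (nu \<Otimes>\<^sub>M nu)"
  proof -
    have [measurable]: "fst \<in> borel_measurable (nu \<Otimes>\<^sub>M nu)" "snd \<in> borel_measurable (nu \<Otimes>\<^sub>M nu)"
      by (rule measurable_compose[OF measurable_fst measurable_ident_nu])
        (rule measurable_compose[OF measurable_snd measurable_ident_nu])
    show ?thesis unfolding k_def case_prod_beta' by measurable
  qed
  show "AE v in nu. 0 < k u v" for u
    using AE_nu_neq[of u] by eventually_elim (simp add: k_def g_pos)
  show "0 \<le> C" unfolding C_def by (auto intro!: add_nonneg_nonneg integral_nonneg_AE)
qed (use k_column k_nonneg nu.emeasure_space_1 in \<open>auto simp: k_def abs_minus_commute\<close>)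

lemma tail_tendsto: "(\<lambda>n. \<integral>t. tail n t \<partial>lborel) \<longlonglongrightarrow> 0"
  and tail_integrable: "integrable lborel (tail n)"
proof -
  have le: "norm (tail n t) \<le> indicator {-1..1} t * \<bar>t\<bar> powr (- 2 * \<alpha>)" for n t
  proof (cases "\<bar>t\<bar> \<le> 1")
    case True
    have "tail n t \<le> (\<bar>t\<bar> powr - \<alpha>)\<^sup>2" unfolding tail_def by (intro power_mono) auto
    moreover have "0 \<le> tail n t" by (simp add: tail_def)
    ultimately show ?thesis using True by (simp add: powr_square indicator_def abs_le_iff)
  next
    case False
    then have "\<bar>t\<bar> powr - \<alpha> \<le> 1" by (intro powr_le_1) simp
    then show ?thesis by (simp add: tail_def)
  qed
  have lim: "(\<lambda>n. tail n t) \<longlonglongrightarrow> 0" for t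
  proof (rule tendsto_eventually)
    obtain N where N: "\<bar>t\<bar> powr - \<alpha> \<le> real N" using real_arch_simple by blast
    show "\<forall>\<^sub>F n in sequentially. tail n t = 0"
      using eventually_ge_at_top[of N]
    proof eventually_elim
      fix n assume "N \<le> n"
      then have "real N \<le> real n" by simp
      with N show "tail n t = 0" by (simp add: tail_def)
    qed
  qed
  have [measurable]: "tail n \<in> borel_measurable borel" for n unfolding tail_def by measurable
  show "integrable lborel (tail n)"
    by (rule Bochner_Integration.integrable_bound[OF singularity_integrable])
      (use le in \<open>auto intro: order.trans[OF _ abs_ge_self]\<close>)
  have "(\<lambda>n. \<integral>t. tail n t \<partial>lborel) \<longlonglongrightarrow> (\<integral>t. 0 \<partial>(lborel :: real measure))"
    by (rule integral_dominated_convergence[OF _ _ singularity_integrable]) (use le lim in auto)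
  then show "(\<lambda>n. \<integral>t. tail n t \<partial>lborel) \<longlonglongrightarrow> 0" by simp
qed

definition truncated :: "nat \<Rightarrow> real \<Rightarrow> real \<Rightarrow> real" where
  "truncated n u v = min (k u v) (Suc n)"

lemma truncated_L2: "truncated n u \<in> L2 nu"
proof (rule nu.L2_bounded)
  show "truncated n u \<in> borel_measurable nu" unfolding truncated_def by measurable
  show "\<bar>truncated n u v\<bar> \<le> Suc n" for v
    using k_nonneg[of u v] by (auto simp: truncated_def min_def)
qed

lemma truncation_error: "(\<integral>v. (k u v - truncated n u v)\<^sup>2 \<partial>nu) \<le> (\<integral>t. tail n t \<partial>lborel)"
proof -
  have "(\<integral>v. (k u v - truncated n u v)\<^sup>2 \<partial>nu) \<le> (\<integral>v. tail n (u - v) \<partial>nu)"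
  proof (rule integral_mono)
    show "integrable nu (\<lambda>v. (k u v - truncated n u v)\<^sup>2)"
      by (intro L2_square_integrable L2_diff k_column truncated_L2)
    show "integrable nu (\<lambda>v. tail n (u - v))"
      by (rule nu_reflected_translate[OF tail_integrable]) (simp add: tail_def)
    show "(k u v - truncated n u v)\<^sup>2 \<le> tail n (u - v)" for v
      unfolding tail_def by (intro power_mono) (use k_le[of u v] in \<open>auto simp: truncated_def min_def max_def\<close>)
  qed
  also have "\<dots> \<le> (\<integral>t. tail n t \<partial>lborel)"
    by (rule nu_reflected_translate[OF tail_integrable]) (simp add: tail_def)
  finally show ?thesis .
qed

text \<open>
The truncated kernel is bounded and continuous off the diagonal, so its columns are continuous in \<open>L\<^sup>2\<close> by dominated
convergence. The kernel itself has no common majorant for nearby columns, as the singularity moves.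
\<close>

lemma truncated_continuous:
  assumes w: "w \<longlonglongrightarrow> u"
  shows "(\<lambda>i. \<integral>v. (truncated n u v - truncated n (w i) v)\<^sup>2 \<partial>nu) \<longlonglongrightarrow> 0"
proof -
  have [measurable]: "truncated n u \<in> borel_measurable nu" for u by (rule L2_measurable[OF truncated_L2])
  have "(\<lambda>i. \<integral>v. (truncated n u v - truncated n (w i) v)\<^sup>2 \<partial>nu) \<longlonglongrightarrow> (\<integral>v. 0 \<partial>nu)"
  proof (rule integral_dominated_convergence[where w = "\<lambda>_. (real (Suc n))\<^sup>2"])
    show "AE v in nu. (\<lambda>i. (truncated n u v - truncated n (w i) v)\<^sup>2) \<longlonglongrightarrow> 0"
      using AE_nu_neq[of u]
    proof eventually_elim
      fix v assume "v \<noteq> u"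
      then have "isCont g \<bar>u - v\<bar>" by (intro g_cont) simp
      moreover have "(\<lambda>i. \<bar>w i - v\<bar>) \<longlonglongrightarrow> \<bar>u - v\<bar>" by (intro tendsto_intros w)
      ultimately have "(\<lambda>i. k (w i) v) \<longlonglongrightarrow> k u v"
        unfolding k_def by (rule isCont_tendsto_compose)
      then have "(\<lambda>i. (truncated n u v - truncated n (w i) v)\<^sup>2) \<longlonglongrightarrow> (truncated n u v - truncated n u v)\<^sup>2"
        unfolding truncated_def by (intro tendsto_intros)
      then show "(\<lambda>i. (truncated n u v - truncated n (w i) v)\<^sup>2) \<longlonglongrightarrow> 0" by simp
    qed
    show "AE v in nu. norm ((truncated n u v - truncated n (w i) v)\<^sup>2) \<le> (real (Suc n))\<^sup>2" for i
    proof (rule AE_I2)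
      fix v
      have "\<bar>truncated n u v - truncated n (w i) v\<bar> \<le> \<bar>real (Suc n)\<bar>"
        using k_nonneg[of u v] k_nonneg[of "w i" v] by (auto simp: truncated_def min_def)
      then show "norm ((truncated n u v - truncated n (w i) v)\<^sup>2) \<le> (real (Suc n))\<^sup>2"
        by (simp only: abs_le_square_iff real_norm_def abs_power2)
    qed
  qed auto
  then show ?thesis by simp
qed

text \<open>
Three steps, each with a small \<open>L\<^sup>2\<close> error: truncate the column at \<open>u\<close>, move it to a nearby rational point, and
undo the truncation there. The truncation error is small uniformly in the point.
\<close>

lemma columns_separable:
  assumes u: "0 \<le> u" and e: "0 < e"
  shows "\<exists>w\<in>\<rat> \<inter> {0..}. (\<integral>v. (k u v - k w v)\<^sup>2 \<partial>nu) < e"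
proof -
  obtain n where n: "(\<integral>t. tail n t \<partial>lborel) < e / 16"
    using order_tendstoD(2)[OF tail_tendsto, of "e / 16"] e by (auto simp: eventually_sequentially)
  obtain w where wD: "\<forall>i. w i \<in> \<rat> \<inter> {0..}" and w: "w \<longlonglongrightarrow> u"
    using nonneg_rational_sequence[OF u] by blast
  obtain i where i: "(\<integral>v. (truncated n u v - truncated n (w i) v)\<^sup>2 \<partial>nu) < e / 16"
    using order_tendstoD(2)[OF truncated_continuous[OF w, of n], of "e / 16"] e
    by (auto simp: eventually_sequentially)
  let ?a = "\<lambda>v. k u v - truncated n u v"
  let ?b = "\<lambda>v. truncated n u v - truncated n (w i) v"
  let ?c = "\<lambda>v. (-1) * (k (w i) v - truncated n (w i) v)"
  have L: "?a \<in> L2 nu" "?b \<in> L2 nu" "?c \<in> L2 nu"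
    by (intro L2_cmult L2_diff k_column truncated_L2)+
  have "(\<integral>v. (k u v - k (w i) v)\<^sup>2 \<partial>nu) = (\<integral>v. (?a v + (?b v + ?c v))\<^sup>2 \<partial>nu)"
    by (intro Bochner_Integration.integral_cong refl) (simp add: algebra_simps)
  also have "\<dots> \<le> 2 * (\<integral>v. (?a v)\<^sup>2 \<partial>nu) + 2 * (\<integral>v. (?b v + ?c v)\<^sup>2 \<partial>nu)"
    by (intro L2_triangle_square L L2_add)
  also have "(\<integral>v. (?b v + ?c v)\<^sup>2 \<partial>nu) \<le> 2 * (\<integral>v. (?b v)\<^sup>2 \<partial>nu) + 2 * (\<integral>v. (?c v)\<^sup>2 \<partial>nu)"
    by (intro L2_triangle_square L)
  also have "(\<integral>v. (?c v)\<^sup>2 \<partial>nu) = (\<integral>v. (k (w i) v - truncated n (w i) v)\<^sup>2 \<partial>nu)"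
    by (simp only: power_mult_distrib) simp
  finally have "(\<integral>v. (k u v - k (w i) v)\<^sup>2 \<partial>nu) < e"
    using truncation_error[of u n] truncation_error[of "w i" n] n i e by simp
  with wD show ?thesis by blast
qed

sublocale compact_positive_kernel nu k C "\<rat> \<inter> {0..}"
  by standard (use columns_separable in \<open>auto simp: countable_rat\<close>)

end

section \<open>Comparison of the kernels\<close>

lemma self_le_sinh: "0 \<le> y \<Longrightarrow> y \<le> sinh (y :: real)"
proof -
  assume "0 \<le> y"
  have "sinh 0 - 0 \<le> sinh y - y"
  proof (rule DERIV_nonneg_imp_nondecreasing[OF \<open>0 \<le> y\<close>, where f = "\<lambda>x. sinh x - x"])
    fix x :: real
    show "\<exists>d. ((\<lambda>x. sinh x - x) has_real_derivative d) (at x) \<and> 0 \<le> d"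
      by (rule exI[of _ "cosh x - 1"]) (auto intro!: derivative_eq_intros simp: cosh_real_ge_1)
  qed
  then show ?thesis by simp
qed

lemma sinh_le_mult_cosh: "0 \<le> y \<Longrightarrow> sinh y \<le> y * cosh (y :: real)"
proof -
  assume "0 \<le> y"
  have "0 * cosh 0 - sinh 0 \<le> y * cosh y - sinh y"
  proof (rule DERIV_nonneg_imp_nondecreasing[OF \<open>0 \<le> y\<close>, where f = "\<lambda>x. x * cosh x - sinh x"])
    fix x :: real assume "0 \<le> x"
    then show "\<exists>d. ((\<lambda>x. x * cosh x - sinh x) has_real_derivative d) (at x) \<and> 0 \<le> d"
      by (intro exI[of _ "x * sinh x"]) (auto intro!: derivative_eq_intros)
  qed
  then show ?thesis by simp
qed

lemma cosh_le_one_plus_square: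
  fixes y :: real
  assumes "0 \<le> y" "y \<le> 1"
  shows "cosh y \<le> 1 + y\<^sup>2"
proof -
  have "cosh (1::real) \<le> 2"
    using exp_le add_mono[of "exp 1" 3 "exp (- 1)" "1::real"] by (simp add: cosh_def)
  then have c: "cosh x \<le> 2" if "0 \<le> x" "x \<le> 1" for x :: real
    using that cosh_real_nonneg_le_iff[of x 1] by simp
  have "1 + 0\<^sup>2 - cosh 0 \<le> 1 + y\<^sup>2 - cosh y"
  proof (rule DERIV_nonneg_imp_nondecreasing[OF \<open>0 \<le> y\<close>, where f = "\<lambda>x. 1 + x\<^sup>2 - cosh x"])
    fix x :: real assume x: "0 \<le> x" "x \<le> y"
    have "sinh x \<le> x * 2"
      using sinh_le_mult_cosh[of x] mult_left_mono[OF c[of x], of x] x assms by linarith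
    then show "\<exists>d. ((\<lambda>x. 1 + x\<^sup>2 - cosh x) has_real_derivative d) (at x) \<and> 0 \<le> d"
      by (intro exI[of _ "2 * x - sinh x"]) (auto intro!: derivative_eq_intros)
  qed
  then show ?thesis by simp
qed

lemma div_sinh_ge:
  fixes y :: real
  assumes "0 < y"
  shows "1 - y\<^sup>2 \<le> y / sinh y"
proof (cases "y \<le> 1")
  case True
  have "0 \<le> 1 - y\<^sup>2" using True assms by (simp add: power_le_one)
  then have "(1 - y\<^sup>2) * sinh y \<le> (1 - y\<^sup>2) * (y * (1 + y\<^sup>2))"
    using True assms
    by (intro mult_left_mono order.trans[OF sinh_le_mult_cosh mult_left_mono] cosh_le_one_plus_square) auto
  also have "\<dots> = y - y * (y\<^sup>2)\<^sup>2" by (simp add: algebra_simps power2_eq_square)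
  also have "\<dots> \<le> y" using assms by simp
  finally show ?thesis using assms by (simp add: pos_le_divide_eq)
next
  case False
  then have "1 - y\<^sup>2 \<le> 0" by (simp add: one_le_power)
  also have "0 \<le> y / sinh y" using assms by simp
  finally show ?thesis .
qed

lemma kern_infinity: "kern \<alpha> \<infinity> u v = \<bar>u - v\<bar> powr - \<alpha>"
  by (simp add: kern_def)

lemma kern_real: "kern \<alpha> (ereal r) u v = (2 * r * sinh (\<bar>u - v\<bar> / (2 * r))) powr - \<alpha>"
  by (simp add: kern_def)

lemma kern_nonneg: "0 \<le> kern \<alpha> \<kappa> u v"
  by (cases \<kappa>) (simp_all add: kern_def)

lemma kern_diff: "kern \<alpha> \<kappa> \<bar>u - v\<bar> 0 = kern \<alpha> \<kappa> u v"
  by (cases \<kappa>) (simp_all add: kern_def)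

lemma kern_square:
  assumes "0 < \<kappa>"
  shows "(kern \<alpha> \<kappa> u v)\<^sup>2 = kern (2 * \<alpha>) \<kappa> u v"
proof -
  have sq: "(x powr - \<alpha>)\<^sup>2 = x powr - (2 * \<alpha>)" if "0 \<le> x" for x :: real
    using that by (cases "x = 0") (simp_all add: powr_realpow[symmetric] powr_powr mult.commute)
  show ?thesis
    using assms by (cases \<kappa>) (simp_all add: kern_def sq)
qed

lemma kern_le_kern_infinity:
  assumes "0 < r" "0 < \<alpha>"
  shows "kern \<alpha> (ereal r) u v \<le> kern \<alpha> \<infinity> u v"
proof (cases "u = v")
  case False
  have "\<bar>u - v\<bar> \<le> 2 * r * sinh (\<bar>u - v\<bar> / (2 * r))"
    using self_le_sinh[of "\<bar>u - v\<bar> / (2 * r)"] assms by (simp add: field_simps)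
  then show ?thesis
    using assms False by (auto simp: kern_real kern_infinity intro!: powr_mono2')
qed (simp add: kern_real kern_infinity)

text \<open>
With \<open>y = \<bar>u - v\<bar> / (2 * r)\<close> the two kernels differ by the factor \<open>(y / sinh y) powr \<alpha>\<close>, which is at least
\<open>y / sinh y \<ge> 1 - y\<^sup>2\<close>. The resulting error is \<open>\<bar>u - v\<bar> powr (2 - \<alpha>) / (4 * r\<^sup>2)\<close>; replacing the power by a
product of functions of \<open>u\<close> and \<open>v\<close> makes it a perturbation of rank one.
\<close>

lemma kern_infinity_le:
  assumes r: "0 < r" and \<alpha>: "0 < \<alpha>" "\<alpha> \<le> 1" and uv: "0 \<le> u" "0 \<le> v"
  shows "kern \<alpha> \<infinity> u v \<le> kern \<alpha> (ereal r) u v + 1 / (4 * r\<^sup>2) * ((1 + u\<^sup>2) * (1 + v\<^sup>2))"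
proof (cases "u = v")
  case False
  define t where "t = \<bar>u - v\<bar>"
  define y where "y = t / (2 * r)"
  have t: "0 < t" and y: "0 < y" using False r by (simp_all add: t_def y_def)
  have q: "0 \<le> y / sinh y" "y / sinh y \<le> 1"
    using y self_le_sinh[of y] by simp_all
  have "2 * r * sinh y = t * inverse (y / sinh y)"
    using y r by (simp add: y_def field_simps)
  then have k_eq: "kern \<alpha> (ereal r) u v = (t * inverse (y / sinh y)) powr - \<alpha>"
    by (simp add: kern_real t_def[symmetric] y_def[symmetric])
  have *: "(t * inverse q) powr - \<alpha> = t powr - \<alpha> * q powr \<alpha>" if "0 < q" for q
    using that t by (simp add: powr_mult powr_minus inverse_powr)
  have eq: "kern \<alpha> (ereal r) u v = t powr - \<alpha> * (y / sinh y) powr \<alpha>"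
    unfolding k_eq by (rule *) (use y in simp)
  have "1 - y\<^sup>2 \<le> y / sinh y" by (rule div_sinh_ge[OF y])
  also have "\<dots> = (y / sinh y) powr 1" using q y by simp
  also have "\<dots> \<le> (y / sinh y) powr \<alpha>" using q \<alpha> by (intro powr_mono') auto
  finally have "t powr - \<alpha> * (1 - y\<^sup>2) \<le> kern \<alpha> (ereal r) u v"
    unfolding eq by (intro mult_left_mono) auto
  then have "kern \<alpha> \<infinity> u v \<le> kern \<alpha> (ereal r) u v + y\<^sup>2 * t powr - \<alpha>"
    by (simp add: kern_infinity t_def[symmetric] algebra_simps)
  also have "y\<^sup>2 * t powr - \<alpha> = 1 / (4 * r\<^sup>2) * t powr (2 - \<alpha>)"
    using t r by (simp add: y_def power_divide power_mult_distrib powr_diff powr_minus field_simps)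
  also have "t powr (2 - \<alpha>) \<le> 1 + t\<^sup>2"
  proof (cases "t \<le> 1")
    case True
    have "t powr (2 - \<alpha>) \<le> 1 powr (2 - \<alpha>)" using t True \<alpha> by (intro powr_mono2) auto
    then show ?thesis using zero_le_power2[of t] unfolding powr_one_eq_one by linarith
  next
    case False
    then have "t powr (2 - \<alpha>) \<le> t powr 2" using \<alpha> by (intro powr_mono) auto
    then show ?thesis using t by simp
  qed
  also have "1 + t\<^sup>2 \<le> (1 + u\<^sup>2) * (1 + v\<^sup>2)"
  proof -
    have "0 \<le> u * v" "0 \<le> (u * v)\<^sup>2" using uv by simp_all
    then show ?thesis unfolding t_def by (simp add: power2_diff algebra_simps power_mult_distrib)
  qed
  finally show ?thesis using r by (simp add: divide_right_mono)
qed (simp add: kern_real kern_infinity)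

lemma kern_singular_profile:
  assumes \<alpha>: "0 < \<alpha>" "\<alpha> < 1 / 2" and \<kappa>: "0 < \<kappa>"
  shows "singular_profile \<alpha> (\<lambda>t. kern \<alpha> \<kappa> t 0)"
proof (cases \<kappa>)
  case (real r)
  with \<kappa> have r: "0 < r" by simp
  show ?thesis
  proof
    show "(\<lambda>t. kern \<alpha> \<kappa> t 0) \<in> borel_measurable borel"
      unfolding real kern_real sinh_def by measurable
    fix t :: real assume t: "0 < t"
    have "isCont (\<lambda>t. (2 * r * sinh (\<bar>t - 0\<bar> / (2 * r))) powr - \<alpha>) t"
      using r t by (intro continuous_intros) auto
    then show "isCont (\<lambda>t. kern \<alpha> \<kappa> t 0) t" by (simp add: real kern_real)
    show "0 < kern \<alpha> \<kappa> t 0" using r t by (simp add: real kern_real)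
    show "kern \<alpha> \<kappa> t 0 \<le> t powr - \<alpha>"
      using kern_le_kern_infinity[OF r \<alpha>(1), of t 0] t by (simp add: real kern_infinity)
  qed (use \<alpha> in \<open>simp_all add: real kern_real\<close>)
next
  case PInf
  show ?thesis
  proof
    fix t :: real assume t: "0 < t"
    have "isCont (\<lambda>t. \<bar>t - 0\<bar> powr - \<alpha>) t"
      using t by (intro continuous_intros) auto
    then show "isCont (\<lambda>t. kern \<alpha> \<kappa> t 0) t" by (simp add: PInf kern_infinity)
  qed (use \<alpha> in \<open>simp_all add: PInf kern_infinity\<close>)
qed (use \<kappa> in simp)

lemma kern_compact_positive:
  assumes "0 < \<alpha>" "\<alpha> < 1 / 2" "0 < \<kappa>"
  shows "compact_positive_kernel nu (kern \<alpha> \<kappa>) (singular_profile.C \<alpha>) (\<rat> \<inter> {0..})"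
proof -
  interpret P: singular_profile \<alpha> "\<lambda>t. kern \<alpha> \<kappa> t 0"
    using assms by (rule kern_singular_profile)
  have "P.k = kern \<alpha> \<kappa>" by (simp add: P.k_def fun_eq_iff kern_diff)
  with P.compact_positive_kernel_axioms show ?thesis by simp
qed

lemma
  assumes "0 < \<alpha>" "\<alpha> < 1 / 2" "0 < \<kappa>"
  shows D2_eq_top: "D2 \<alpha> \<kappa> = positive_kernel.form_sup nu (kern \<alpha> \<kappa>)"
    and D2_eigenvalue: "L2_eigenvalue nu (S_op \<alpha> \<kappa>) (D2 \<alpha> \<kappa>)"
    and eigenvalue_le_D2: "L2_eigenvalue nu (S_op \<alpha> \<kappa>) l \<Longrightarrow> l \<le> D2 \<alpha> \<kappa>"
    and D2_pos: "0 < D2 \<alpha> \<kappa>"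
proof -
  interpret K: compact_positive_kernel nu "kern \<alpha> \<kappa>" "singular_profile.C \<alpha>" "\<rat> \<inter> {0..}"
    using assms by (rule kern_compact_positive)
  have S: "S_op \<alpha> \<kappa> = K.T" by (simp add: fun_eq_iff S_op_def K.T_def)
  show D: "D2 \<alpha> \<kappa> = K.form_sup" by (simp add: D2_def S K.lambda_max_eq_top)
  show "L2_eigenvalue nu (S_op \<alpha> \<kappa>) (D2 \<alpha> \<kappa>)" unfolding D S by (rule K.top_eigenvalue)
  show "l \<le> D2 \<alpha> \<kappa>" if "L2_eigenvalue nu (S_op \<alpha> \<kappa>) l"
    using that unfolding D S by (rule K.eigenvalue_le_top)
  show "0 < D2 \<alpha> \<kappa>" unfolding D by (rule K.top_pos)
qed

lemma D2_perturbation: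
  assumes \<alpha>: "0 < \<alpha>" "\<alpha> < 1 / 2" and r: "0 < r"
  shows "D2 \<alpha> (ereal r) \<le> D2 \<alpha> \<infinity>"
    and "D2 \<alpha> \<infinity> \<le> D2 \<alpha> (ereal r) + 1 / (4 * r\<^sup>2) * (\<integral>u. (1 + u\<^sup>2)\<^sup>2 \<partial>nu)"
proof -
  interpret K: compact_positive_kernel nu "kern \<alpha> (ereal r)" "singular_profile.C \<alpha>" "\<rat> \<inter> {0..}"
    by (rule kern_compact_positive) (use \<alpha> r in auto)
  interpret I: compact_positive_kernel nu "kern \<alpha> \<infinity>" "singular_profile.C \<alpha>" "\<rat> \<inter> {0..}"
    by (rule kern_compact_positive) (use \<alpha> in auto)
  have D: "D2 \<alpha> (ereal r) = K.form_sup" "D2 \<alpha> \<infinity> = I.form_sup"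
    using \<alpha> r by (simp_all add: D2_eq_top)
  show "D2 \<alpha> (ereal r) \<le> D2 \<alpha> \<infinity>"
    unfolding D
    using top_le_perturbation[OF K.positive_kernel_axioms I.positive_kernel_axioms one_plus_square_L2, of 0]
      kern_le_kern_infinity[OF r \<alpha>(1)] by simp
  show "D2 \<alpha> \<infinity> \<le> D2 \<alpha> (ereal r) + 1 / (4 * r\<^sup>2) * (\<integral>u. (1 + u\<^sup>2)\<^sup>2 \<partial>nu)"
    unfolding D
    by (rule top_le_perturbation[OF I.positive_kernel_axioms K.positive_kernel_axioms one_plus_square_L2])
      (use kern_infinity_le[OF r \<alpha>(1)] \<alpha> r in auto)
qed

section \<open>The exponential chart of the unit interval\<close>

lemma AE_unit_leb: "(AE x in unit_leb. P x) \<longleftrightarrow> (AE x in lborel. 0 < x \<and> x < 1 \<longrightarrow> P x)"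
  by (subst AE_restrict_space_iff) auto

lemma measurable_unit_leb: "f \<in> borel_measurable borel \<Longrightarrow> f \<in> borel_measurable unit_leb"
  by (simp add: measurable_restrict_space1)

lemma L2_borel_representative:
  fixes f :: "real \<Rightarrow> real"
  assumes f: "f \<in> borel_measurable (restrict_space borel S)" and S: "S \<in> sets borel"
  shows "(\<lambda>x. indicator S x * f x) \<in> borel_measurable borel"
  using f S by (subst (asm) borel_measurable_restrict_space_iff) auto

text \<open>
The pull-back of the Lebesgue measure on the unit interval under the substitution \<open>x = exp (- u / \<kappa>)\<close>,
written as a density with respect to the exponential measure. The point \<open>u = 0\<close> is mapped outside the open interval, which
is why the change of variables runs over the positive half-line.
\<close>

lemma chart_measure:
  assumes "0 < \<kappa>"
  shows "density lborel (\<lambda>x. ennreal (indicator {0<..<1} x))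
    = distr (density nu (\<lambda>u. ennreal (exp (u - u / \<kappa>) / \<kappa>))) borel (\<lambda>u. exp (- u / \<kappa>))"
    (is "?L = distr ?N borel ?\<phi>")
proof (rule measure_eqI)
  show "sets ?L = sets (distr ?N borel ?\<phi>)" by simp
  fix A assume "A \<in> sets ?L"
  then have A [measurable]: "A \<in> sets borel" by simp
  have \<phi>: "?\<phi> \<in> borel_measurable nu" by (rule measurable_nu_borel) simp
  have p: "(\<lambda>u. ennreal (exp (u - u / \<kappa>) / \<kappa>)) \<in> borel_measurable nu" by (rule measurable_nu_borel) simp
  have image: "?\<phi> ` {0<..} = {0<..<1}"
  proof (intro equalityI subsetI)
    fix x assume "x \<in> {0<..<1::real}"
    then have "x = ?\<phi> (- \<kappa> * ln x)" "- \<kappa> * ln x \<in> {0<..}" using assms by (auto simp: mult_pos_neg)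
    then show "x \<in> ?\<phi> ` {0<..}" by blast
  qed (use assms in auto)
  define b where "b = integral {0<..<1} (indicator A :: real \<Rightarrow> real)"
  have ai: "(indicator A :: real \<Rightarrow> real) absolutely_integrable_on {0<..<1}"
  proof -
    have "set_integrable lborel {0<..<1} (indicator A :: real \<Rightarrow> real)"
      unfolding set_integrable_def
      by (rule Bochner_Integration.integrable_bound[of lborel "indicator {0<..<1} :: real \<Rightarrow> real"])
        (auto split: split_indicator)
    then show ?thesis unfolding set_integrable_def by (subst integrable_completion) auto
  qed
  have "(\<lambda>u. \<bar>- exp (- u / \<kappa>) / \<kappa>\<bar> * indicator A (?\<phi> u)) absolutely_integrable_on {0<..} \<and>
        integral {0<..} (\<lambda>u. \<bar>- exp (- u / \<kappa>) / \<kappa>\<bar> * indicator A (?\<phi> u)) = b"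
  proof (rule has_absolute_integral_change_of_variables_1'[where f = "indicator A", THEN iffD2])
    show "(?\<phi> has_real_derivative - exp (- u / \<kappa>) / \<kappa>) (at u within {0<..})" for u
      using assms by (auto intro!: derivative_eq_intros)
    show "inj_on ?\<phi> {0<..}" using assms by (auto simp: inj_on_def)
  qed (use ai image in \<open>auto simp: b_def\<close>)
  then have I: "((\<lambda>u. exp (- u / \<kappa>) / \<kappa> * indicator A (?\<phi> u)) has_integral b) {0<..}"
    using assms by (auto simp: has_integral_iff dest: set_lebesgue_integral_eq_integral)
  have J: "((indicator A :: real \<Rightarrow> real) has_integral b) {0<..<1}"
    using ai by (auto simp: has_integral_iff b_def dest: set_lebesgue_integral_eq_integral)
  have "emeasure ?L A = (\<integral>\<^sup>+x. ennreal (indicator {0<..<1} x * indicator A x) \<partial>lborel)"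
    by (subst emeasure_density) (auto intro!: nn_integral_cong split: split_indicator)
  also have "\<dots> = b" using nn_integral_has_integral_lebesgue[OF _ J] by simp
  also have "ennreal b = (\<integral>\<^sup>+u. ennreal (indicator {0<..} u * (exp (- u / \<kappa>) / \<kappa> * indicator A (?\<phi> u))) \<partial>lborel)"
    using nn_integral_has_integral_lebesgue[OF _ I] assms by simp
  also have "\<dots> = (\<integral>\<^sup>+u. ennreal (exp (- u)) * (ennreal (exp (u - u / \<kappa>) / \<kappa>) * indicator A (?\<phi> u)) * indicator {0..} u \<partial>lborel)"
    using AE_lborel_singleton[of "0::real"] assms
    by (intro nn_integral_cong_AE)
      (auto elim!: eventually_mono split: split_indicator simp: ennreal_mult'[symmetric] exp_add[symmetric])
  also have "\<dots> = (\<integral>\<^sup>+u. ennreal (exp (u - u / \<kappa>) / \<kappa>) * indicator A (?\<phi> u) \<partial>nu)"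
    by (rule nn_integral_nu[symmetric]) (rule measurable_nu_borel, measurable)
  also have "\<dots> = (\<integral>\<^sup>+u. indicator A (?\<phi> u) \<partial>?N)"
    by (subst nn_integral_density[OF p]) (auto intro!: measurable_nu_borel)
  also have "\<dots> = emeasure (distr ?N borel ?\<phi>) A"
    using \<phi> by (subst nn_integral_distr[symmetric, where M' = borel]) (auto simp: )
  finally show "emeasure ?L A = emeasure (distr ?N borel ?\<phi>) A" .
qed

context
  fixes \<kappa> :: real
  assumes \<kappa>: "0 < \<kappa>"
begin

definition chart :: "real \<Rightarrow> real" where
  "chart u = exp (- u / \<kappa>)"

text \<open>
The square root of \<open>\<kappa>\<close> times the density of the pulled-back Lebesgue measure with respect to the exponential measure, so
multiplication by it turns square-integrable functions of \<open>x\<close> into square-integrable functions of \<open>u\<close>.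
\<close>

definition weight :: "real \<Rightarrow> real" where
  "weight u = exp ((u - u / \<kappa>) / 2)"

lemma weight_pos: "0 < weight u"
  by (simp add: weight_def)

lemma weight_square: "(weight u)\<^sup>2 = exp (u - u / \<kappa>)"
  by (simp add: weight_def exp_double[symmetric])

lemma chart_measurable [measurable]: "chart \<in> borel_measurable borel"
  unfolding chart_def by measurable

lemma weight_measurable [measurable]: "weight \<in> borel_measurable borel"
  unfolding weight_def by measurable

lemma chart_measure':
  "density lborel (\<lambda>x. ennreal (indicator {0<..<1} x))
    = distr (density nu (\<lambda>u. ennreal ((weight u)\<^sup>2 / \<kappa>))) borel chart"
  using chart_measure[OF \<kappa>] by (simp add: weight_square chart_def[abs_def])

lemma integral_unit_leb:
  fixes f :: "real \<Rightarrow> real"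
  assumes [measurable]: "f \<in> borel_measurable borel"
  shows "(\<integral>x. f x \<partial>unit_leb) = (\<integral>u. (weight u)\<^sup>2 / \<kappa> * f (chart u) \<partial>nu)"
proof -
  have "(\<integral>x. f x \<partial>unit_leb) = (\<integral>x. f x \<partial>density lborel (\<lambda>x. ennreal (indicator {0<..<1} x)))"
    by (subst integral_density) (auto simp: integral_restrict_space)
  also have "\<dots> = (\<integral>u. f (chart u) \<partial>density nu (\<lambda>u. ennreal ((weight u)\<^sup>2 / \<kappa>)))"
    unfolding chart_measure' by (subst integral_distr) (auto intro!: measurable_nu_borel)
  also have "\<dots> = (\<integral>u. (weight u)\<^sup>2 / \<kappa> * f (chart u) \<partial>nu)"
    using \<kappa> by (subst integral_density) (auto intro!: measurable_nu_borel)
  finally show ?thesis .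
qed

lemma integrable_unit_leb:
  fixes f :: "real \<Rightarrow> real"
  assumes [measurable]: "f \<in> borel_measurable borel"
  shows "integrable unit_leb f \<longleftrightarrow> integrable nu (\<lambda>u. (weight u)\<^sup>2 / \<kappa> * f (chart u))"
proof -
  have "integrable unit_leb f \<longleftrightarrow> integrable (density lborel (\<lambda>x. ennreal (indicator {0<..<1} x))) f"
    by (subst integrable_density) (auto simp: integrable_restrict_space)
  also have "\<dots> \<longleftrightarrow> integrable (density nu (\<lambda>u. ennreal ((weight u)\<^sup>2 / \<kappa>))) (\<lambda>u. f (chart u))"
    unfolding chart_measure' by (subst integrable_distr_eq) (auto intro!: measurable_nu_borel)
  also have "\<dots> \<longleftrightarrow> integrable nu (\<lambda>u. (weight u)\<^sup>2 / \<kappa> * f (chart u))"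
    using \<kappa> by (subst integrable_density) (auto intro!: measurable_nu_borel)
  finally show ?thesis .
qed

lemma AE_unit_leb_chart:
  assumes "Measurable.pred borel P"
  shows "(AE x in unit_leb. P x) \<longleftrightarrow> (AE u in nu. P (chart u))"
proof -
  have P: "{x. P x} \<in> sets borel" using assms by (simp add: pred_def)
  have "(AE x in unit_leb. P x) \<longleftrightarrow> (AE x in density lborel (\<lambda>x. ennreal (indicator {0<..<1} x)). P x)"
    unfolding AE_unit_leb by (subst AE_density) (auto split: split_indicator intro!: AE_cong simp: indicator_def)
  also have "\<dots> \<longleftrightarrow> (AE u in density nu (\<lambda>u. ennreal ((weight u)\<^sup>2 / \<kappa>)). P (chart u))"
    unfolding chart_measure' using P by (subst AE_distr_iff) (auto intro!: measurable_nu_borel)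
  also have "\<dots> \<longleftrightarrow> (AE u in nu. P (chart u))"
    using \<kappa> weight_pos by (subst AE_density) (auto intro!: measurable_nu_borel simp: less_imp_neq[symmetric])
  finally show ?thesis .
qed

lemma chart_kernel:
  "chart u powr - c * chart v powr - c * \<bar>chart u - chart v\<bar> powr - \<beta>
    = \<kappa> powr \<beta> * exp ((c + \<beta> / 2) * (u + v) / \<kappa>) * kern \<beta> (ereal \<kappa>) u v"
proof -
  define m where "m = (u + v) / (2 * \<kappa>)"
  define t where "t = \<bar>u - v\<bar> / (2 * \<kappa>)"
  have t0: "0 \<le> sinh t" using \<kappa> by (simp add: t_def)
  have "\<bar>chart u - chart v\<bar> = exp (- m) * (2 * sinh t)"
  proof (cases "u \<le> v")
    case True
    then have "\<bar>chart u - chart v\<bar> = chart u - chart v" using \<kappa> by (simp add: chart_def divide_right_mono)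
    moreover have "- u / \<kappa> = - m + t" "- v / \<kappa> = - m + - t"
      using True \<kappa> by (simp_all add: m_def t_def field_simps)
    ultimately show ?thesis unfolding chart_def sinh_def by (simp only: exp_add) (simp add: algebra_simps)
  next
    case False
    then have "\<bar>chart u - chart v\<bar> = chart v - chart u" using \<kappa> by (simp add: chart_def divide_right_mono)
    moreover have "- v / \<kappa> = - m + t" "- u / \<kappa> = - m + - t"
      using False \<kappa> by (simp_all add: m_def t_def field_simps)
    ultimately show ?thesis unfolding chart_def sinh_def by (simp only: exp_add) (simp add: algebra_simps)
  qed
  also have "\<dots> powr - \<beta> = exp (\<beta> * m) * (2 * sinh t) powr - \<beta>"
    using t0 by (simp add: powr_mult exp_powr_real mult.commute)
  also have "(2 * sinh t) powr - \<beta> = \<kappa> powr \<beta> * kern \<beta> (ereal \<kappa>) u v"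
    unfolding kern_real t_def[symmetric]
    using t0 \<kappa> by (simp add: powr_mult powr_minus field_simps)
  finally have "\<bar>chart u - chart v\<bar> powr - \<beta> = exp (\<beta> * m) * (\<kappa> powr \<beta> * kern \<beta> (ereal \<kappa>) u v)" .
  moreover have "chart u powr - c = exp (c * u / \<kappa>)" "chart v powr - c = exp (c * v / \<kappa>)"
    by (simp_all add: chart_def exp_powr_real mult.commute)
  moreover have "exp ((c + \<beta> / 2) * (u + v) / \<kappa>) = exp (c * u / \<kappa>) * exp (c * v / \<kappa>) * exp (\<beta> * m)"
    unfolding exp_add[symmetric] using \<kappa> by (simp add: m_def field_simps)
  ultimately show ?thesis by simp
qed

end

section \<open>Correspondence of the eigenvalues\<close>

text \<open>
The exponents of the three factors add up to \<open>(u + v) / 2 * (1 - 1 / \<kappa> + (d + \<alpha>) / \<kappa>)\<close>, which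
vanishes for this choice of \<open>\<kappa>\<close>.
\<close>

lemma weight_kernel_cancel:
  assumes \<kappa>: "0 < \<kappa>" "\<kappa> = 1 - d - \<alpha>"
  shows "weight \<kappa> u * weight \<kappa> v * exp ((d / 2 + \<alpha> / 2) * (u + v) / \<kappa>) = 1"
proof -
  have d: "d = 1 - \<kappa> - \<alpha>" using \<kappa> by simp
  have "(u - u / \<kappa>) / 2 + (v - v / \<kappa>) / 2 + (d / 2 + \<alpha> / 2) * (u + v) / \<kappa> = 0"
    unfolding d using \<kappa>(1) by (simp add: field_simps)
  then show ?thesis using \<kappa>(1) by (simp add: weight_def exp_add[symmetric])
qed

lemma S_op_chart:
  assumes \<kappa>: "0 < \<kappa>" "\<kappa> = 1 - d - \<alpha>"
    and f [measurable]: "f \<in> borel_measurable borel"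
  shows "S_op \<alpha> (ereal \<kappa>) (\<lambda>v. f (chart \<kappa> v) * weight \<kappa> v) u
    = \<kappa> powr (1 - \<alpha>) * weight \<kappa> u * T_op \<alpha> d f (chart \<kappa> u)"
proof -
  have w: "0 < weight \<kappa> u" using weight_pos[OF \<kappa>(1)] .
  have "T_op \<alpha> d f (chart \<kappa> u) = (\<integral>v. (weight \<kappa> v)\<^sup>2 / \<kappa> *
      (chart \<kappa> u powr (- d / 2) * chart \<kappa> v powr (- d / 2) * \<bar>chart \<kappa> u - chart \<kappa> v\<bar> powr (- \<alpha>) * f (chart \<kappa> v)) \<partial>nu)"
    unfolding T_op_def by (rule integral_unit_leb[OF \<kappa>(1)]) measurable
  also have "\<dots> = (\<integral>v. \<kappa> powr (\<alpha> - 1) / weight \<kappa> u *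
      (kern \<alpha> (ereal \<kappa>) u v * (f (chart \<kappa> v) * weight \<kappa> v)) \<partial>nu)"
  proof (rule Bochner_Integration.integral_cong[OF refl])
    fix v
    define E where "E = exp ((d / 2 + \<alpha> / 2) * (u + v) / \<kappa>)"
    have "chart \<kappa> u powr (- d / 2) * chart \<kappa> v powr (- d / 2) * \<bar>chart \<kappa> u - chart \<kappa> v\<bar> powr (- \<alpha>)
      = \<kappa> powr \<alpha> * E * kern \<alpha> (ereal \<kappa>) u v"
      using chart_kernel[OF \<kappa>(1), of u "d / 2" v \<alpha>] by (simp add: E_def)
    moreover have "weight \<kappa> v * E = 1 / weight \<kappa> u"
      using weight_kernel_cancel[OF \<kappa>, of u v] w by (simp add: E_def field_simps)
    then have "(weight \<kappa> v)\<^sup>2 * E = weight \<kappa> v / weight \<kappa> u"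
      by (simp add: power2_eq_square mult.assoc)
    moreover have "(weight \<kappa> v)\<^sup>2 / \<kappa> * (\<kappa> powr \<alpha> * E * kern \<alpha> (ereal \<kappa>) u v * f (chart \<kappa> v))
      = \<kappa> powr \<alpha> / \<kappa> * ((weight \<kappa> v)\<^sup>2 * E) * kern \<alpha> (ereal \<kappa>) u v * f (chart \<kappa> v)"
      by simp
    moreover have "\<kappa> powr \<alpha> / \<kappa> = \<kappa> powr (\<alpha> - 1)" using \<kappa>(1) by (simp add: powr_diff)
    ultimately show "(weight \<kappa> v)\<^sup>2 / \<kappa> *
      (chart \<kappa> u powr (- d / 2) * chart \<kappa> v powr (- d / 2) * \<bar>chart \<kappa> u - chart \<kappa> v\<bar> powr (- \<alpha>) * f (chart \<kappa> v))
      = \<kappa> powr (\<alpha> - 1) / weight \<kappa> u * (kern \<alpha> (ereal \<kappa>) u v * (f (chart \<kappa> v) * weight \<kappa> v))"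
      by simp
  qed
  also have "\<dots> = \<kappa> powr (\<alpha> - 1) / weight \<kappa> u * S_op \<alpha> (ereal \<kappa>) (\<lambda>v. f (chart \<kappa> v) * weight \<kappa> v) u"
    unfolding S_op_def by (rule integral_mult_right_zero)
  finally have "T_op \<alpha> d f (chart \<kappa> u)
    = \<kappa> powr (\<alpha> - 1) / weight \<kappa> u * S_op \<alpha> (ereal \<kappa>) (\<lambda>v. f (chart \<kappa> v) * weight \<kappa> v) u" .
  then have "\<kappa> powr (1 - \<alpha>) * weight \<kappa> u * T_op \<alpha> d f (chart \<kappa> u)
    = (\<kappa> powr (1 - \<alpha>) * \<kappa> powr (\<alpha> - 1)) * S_op \<alpha> (ereal \<kappa>) (\<lambda>v. f (chart \<kappa> v) * weight \<kappa> v) u"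
    using w by simp
  also have "\<kappa> powr (1 - \<alpha>) * \<kappa> powr (\<alpha> - 1) = 1"
    using \<kappa>(1) by (simp add: powr_add[symmetric])
  finally show ?thesis by simp
qed

definition eigenfunction :: "'a measure \<Rightarrow> (('a \<Rightarrow> real) \<Rightarrow> 'a \<Rightarrow> real) \<Rightarrow> real \<Rightarrow> ('a \<Rightarrow> real) \<Rightarrow> bool" where
  "eigenfunction M T l f \<longleftrightarrow> f \<in> L2 M \<and> \<not> (AE x in M. f x = 0) \<and> (AE x in M. T f x = l * f x)"

lemma L2_eigenvalue_iff: "L2_eigenvalue M T l \<longleftrightarrow> (\<exists>f. eigenfunction M T l f)"
  by (simp only: L2_eigenvalue_def eigenfunction_def Bex_def)

lemma L2_eigenvalueI: "eigenfunction M T l f \<Longrightarrow> L2_eigenvalue M T l"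
  unfolding L2_eigenvalue_iff by (rule exI)

lemma eigenfunction_cong:
  assumes "\<And>x. x \<in> space M \<Longrightarrow> f x = g x" and T: "T f = T g"
  shows "eigenfunction M T l f \<longleftrightarrow> eigenfunction M T l g"
proof -
  have "f \<in> borel_measurable M \<longleftrightarrow> g \<in> borel_measurable M"
    using assms by (intro measurable_cong) auto
  moreover have "integrable M (\<lambda>x. (f x)\<^sup>2) \<longleftrightarrow> integrable M (\<lambda>x. (g x)\<^sup>2)"
    using assms by (intro Bochner_Integration.integrable_cong) auto
  moreover have "(AE x in M. f x = 0) \<longleftrightarrow> (AE x in M. g x = 0)"
    using assms by (intro AE_cong) auto
  moreover have "(AE x in M. T f x = l * f x) \<longleftrightarrow> (AE x in M. T g x = l * g x)"
    using assms by (intro AE_cong) auto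
  ultimately show ?thesis by (simp add: eigenfunction_def L2_def)
qed

lemma T_op_measurable:
  assumes [measurable]: "f \<in> borel_measurable borel"
  shows "T_op \<alpha> d f \<in> borel_measurable borel"
proof -
  have "T_op \<alpha> d f = (\<lambda>x. \<integral>y. indicator {0<..<1} y *
      (x powr (- d / 2) * y powr (- d / 2) * \<bar>x - y\<bar> powr (- \<alpha>) * f y) \<partial>lborel)"
    by (simp add: T_op_def fun_eq_iff integral_restrict_space)
  then show ?thesis by simp
qed

text \<open>
Restricted to Borel functions on the whole line, since then both sides of the eigenvalue equation are measurable
and null sets can be transported in both directions.
\<close>

lemma eigenfunction_chart:
  assumes \<kappa>: "0 < \<kappa>" "\<kappa> = 1 - d - \<alpha>"
    and f [measurable]: "f \<in> borel_measurable borel"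
  shows "eigenfunction unit_leb (T_op \<alpha> d) l f \<longleftrightarrow>
    eigenfunction nu (S_op \<alpha> (ereal \<kappa>)) (\<kappa> powr (1 - \<alpha>) * l) (\<lambda>v. f (chart \<kappa> v) * weight \<kappa> v)"
proof -
  note [measurable] = chart_measurable[OF \<kappa>(1)] weight_measurable[OF \<kappa>(1)] T_op_measurable[OF f]
  have w: "0 < weight \<kappa> u" for u using weight_pos[OF \<kappa>(1)] .
  let ?h = "\<lambda>v. f (chart \<kappa> v) * weight \<kappa> v"
  have "?h \<in> borel_measurable nu" by (rule measurable_nu_borel) measurable
  moreover have "f \<in> borel_measurable unit_leb" by (rule measurable_unit_leb[OF f])
  moreover have "integrable unit_leb (\<lambda>x. (f x)\<^sup>2) \<longleftrightarrow> integrable nu (\<lambda>u. (weight \<kappa> u)\<^sup>2 / \<kappa> * (f (chart \<kappa> u))\<^sup>2)"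
    by (rule integrable_unit_leb[OF \<kappa>(1)]) measurable
  moreover have "(\<lambda>u. (weight \<kappa> u)\<^sup>2 / \<kappa> * (f (chart \<kappa> u))\<^sup>2) = (\<lambda>u. (1 / \<kappa>) * (?h u)\<^sup>2)"
    by (simp add: power_mult_distrib mult.commute)
  moreover have "integrable nu (\<lambda>u. (1 / \<kappa>) * (?h u)\<^sup>2) \<longleftrightarrow> integrable nu (\<lambda>u. (?h u)\<^sup>2)"
    using \<kappa>(1) by (subst integrable_mult_left_iff) simp
  ultimately have L2: "f \<in> L2 unit_leb \<longleftrightarrow> ?h \<in> L2 nu"
    by (simp only: L2_def mem_Collect_eq)
  have "(AE x in unit_leb. f x = 0) \<longleftrightarrow> (AE u in nu. f (chart \<kappa> u) = 0)"
    by (rule AE_unit_leb_chart[OF \<kappa>(1)]) measurable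
  also have "\<dots> \<longleftrightarrow> (AE u in nu. ?h u = 0)"
    by (rule AE_cong) (use w in \<open>auto simp: less_le\<close>)
  finally have null: "(AE x in unit_leb. f x = 0) \<longleftrightarrow> (AE u in nu. ?h u = 0)" .
  have "(AE x in unit_leb. T_op \<alpha> d f x = l * f x)
      \<longleftrightarrow> (AE u in nu. T_op \<alpha> d f (chart \<kappa> u) = l * f (chart \<kappa> u))"
    by (rule AE_unit_leb_chart[OF \<kappa>(1)]) measurable
  also have "\<dots> \<longleftrightarrow> (AE u in nu. S_op \<alpha> (ereal \<kappa>) ?h u = \<kappa> powr (1 - \<alpha>) * l * ?h u)"
  proof (rule AE_cong)
    fix u
    have "0 < \<kappa> powr (1 - \<alpha>) * weight \<kappa> u" using w[of u] \<kappa>(1) by simp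
    then have "\<kappa> powr (1 - \<alpha>) * weight \<kappa> u * T_op \<alpha> d f (chart \<kappa> u)
        = \<kappa> powr (1 - \<alpha>) * weight \<kappa> u * (l * f (chart \<kappa> u))
      \<longleftrightarrow> T_op \<alpha> d f (chart \<kappa> u) = l * f (chart \<kappa> u)"
      by (simp only: mult_cancel_left) auto
    then show "(T_op \<alpha> d f (chart \<kappa> u) = l * f (chart \<kappa> u))
      \<longleftrightarrow> (S_op \<alpha> (ereal \<kappa>) ?h u = \<kappa> powr (1 - \<alpha>) * l * ?h u)"
      unfolding S_op_chart[OF \<kappa> f] by (simp add: mult_ac)
  qed
  finally show ?thesis unfolding eigenfunction_def L2 null by blast
qed

text \<open>
Every eigenfunction has a Borel version on the line, extended by zero. On the side of the exponential measure
the substitution is undone by \<open>u = - \<kappa> * ln x\<close>.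
\<close>

lemma eigenvalue_transfer:
  assumes \<kappa>: "0 < \<kappa>" "\<kappa> = 1 - d - \<alpha>"
  shows "L2_eigenvalue unit_leb (T_op \<alpha> d) l \<longleftrightarrow>
    L2_eigenvalue nu (S_op \<alpha> (ereal \<kappa>)) (\<kappa> powr (1 - \<alpha>) * l)"
proof
  assume "L2_eigenvalue unit_leb (T_op \<alpha> d) l"
  then obtain f where f: "eigenfunction unit_leb (T_op \<alpha> d) l f" unfolding L2_eigenvalue_iff by (rule exE)
  let ?f = "\<lambda>x. indicator {0<..<1} x * f x"
  have "f \<in> borel_measurable unit_leb" using f by (simp add: eigenfunction_def L2_def)
  then have fb: "f \<in> borel_measurable (restrict_space borel {0<..<1})"
    by (simp cong: measurable_cong_sets add: sets_restrict_space)
  have meas: "?f \<in> borel_measurable borel" by (rule L2_borel_representative[OF fb]) simp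
  have "eigenfunction unit_leb (T_op \<alpha> d) l ?f"
  proof (rule eigenfunction_cong[THEN iffD1, OF _ _ f])
    show "T_op \<alpha> d f = T_op \<alpha> d ?f"
      unfolding T_op_def
      by (intro ext Bochner_Integration.integral_cong refl) (auto simp: space_restrict_space)
  qed (auto simp: space_restrict_space)
  then show "L2_eigenvalue nu (S_op \<alpha> (ereal \<kappa>)) (\<kappa> powr (1 - \<alpha>) * l)"
    unfolding eigenfunction_chart[OF \<kappa> meas] by (rule L2_eigenvalueI)
next
  assume "L2_eigenvalue nu (S_op \<alpha> (ereal \<kappa>)) (\<kappa> powr (1 - \<alpha>) * l)"
  then obtain h where h: "eigenfunction nu (S_op \<alpha> (ereal \<kappa>)) (\<kappa> powr (1 - \<alpha>) * l) h"
    unfolding L2_eigenvalue_iff by (rule exE)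
  let ?h = "\<lambda>u. indicator {0..} u * h u"
  have "h \<in> borel_measurable nu" using h by (simp add: eigenfunction_def L2_def)
  then have hb: "h \<in> borel_measurable (restrict_space borel {0..})"
    by (simp cong: measurable_cong_sets add: sets_nu)
  have [measurable]: "?h \<in> borel_measurable borel" by (rule L2_borel_representative[OF hb]) simp
  have h': "eigenfunction nu (S_op \<alpha> (ereal \<kappa>)) (\<kappa> powr (1 - \<alpha>) * l) ?h"
  proof (rule eigenfunction_cong[THEN iffD1, OF _ _ h])
    show "S_op \<alpha> (ereal \<kappa>) h = S_op \<alpha> (ereal \<kappa>) ?h"
      unfolding S_op_def by (intro ext Bochner_Integration.integral_cong refl) auto
  qed auto
  define f where "f x = ?h (- \<kappa> * ln x) / weight \<kappa> (- \<kappa> * ln x)" for x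
  note [measurable] = weight_measurable[OF \<kappa>(1)]
  have "(\<lambda>x. ?h (- \<kappa> * ln x)) \<in> borel_measurable borel"
    by (rule measurable_compose[of "\<lambda>x. - \<kappa> * ln x" _ borel ?h]) measurable
  then have meas: "f \<in> borel_measurable borel" unfolding f_def by measurable
  have "f (chart \<kappa> v) * weight \<kappa> v = ?h v" for v
  proof -
    have "- \<kappa> * ln (chart \<kappa> v) = v" using \<kappa>(1) by (simp add: chart_def)
    then show ?thesis using weight_pos[OF \<kappa>(1), of v] unfolding f_def by simp
  qed
  then have "eigenfunction unit_leb (T_op \<alpha> d) l f"
    unfolding eigenfunction_chart[OF \<kappa> meas] using h' by simp
  then show "L2_eigenvalue unit_leb (T_op \<alpha> d) l" by (rule L2_eigenvalueI)
qed

lemma lambda_max_T_op: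
  assumes \<alpha>: "0 < \<alpha>" "\<alpha> < 1 / 2" and \<kappa>: "0 < \<kappa>" "\<kappa> = 1 - d - \<alpha>"
  shows "lambda_max unit_leb (T_op \<alpha> d) = \<kappa> powr (\<alpha> - 1) * D2 \<alpha> (ereal \<kappa>)"
  unfolding lambda_max_def
proof (rule Greatest_equality)
  have inv: "\<kappa> powr (1 - \<alpha>) * \<kappa> powr (\<alpha> - 1) = 1"
    using \<kappa>(1) by (simp add: powr_add[symmetric])
  have \<kappa>': "0 < ereal \<kappa>" using \<kappa> by simp
  show "L2_eigenvalue unit_leb (T_op \<alpha> d) (\<kappa> powr (\<alpha> - 1) * D2 \<alpha> (ereal \<kappa>))"
    unfolding eigenvalue_transfer[OF \<kappa>] mult.assoc[symmetric] inv
    using D2_eigenvalue[OF \<alpha> \<kappa>'] by simp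
  fix l assume "L2_eigenvalue unit_leb (T_op \<alpha> d) l"
  then have "\<kappa> powr (1 - \<alpha>) * l \<le> D2 \<alpha> (ereal \<kappa>)"
    unfolding eigenvalue_transfer[OF \<kappa>] by (rule eigenvalue_le_D2[OF \<alpha> \<kappa>'])
  then have "\<kappa> powr (\<alpha> - 1) * (\<kappa> powr (1 - \<alpha>) * l) \<le> \<kappa> powr (\<alpha> - 1) * D2 \<alpha> (ereal \<kappa>)"
    by (rule mult_left_mono) simp
  then show "l \<le> \<kappa> powr (\<alpha> - 1) * D2 \<alpha> (ereal \<kappa>)"
    unfolding mult.assoc[symmetric] mult.commute[of "\<kappa> powr (\<alpha> - 1)" "\<kappa> powr (1 - \<alpha>)"] inv by simp
qed

section \<open>The trace of the square\<close>

text \<open>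
The distance of two independent standard exponential variables has the standard exponential distribution. By
symmetry the double integral is twice the part with \<open>u < v\<close>, where the substitution \<open>v = u + t\<close> factors the
density into \<open>exp (- 2 * u) * exp (- t)\<close>.
\<close>

lemma nn_integral_nu_distance:
  fixes h :: "real \<Rightarrow> real"
  assumes [measurable]: "h \<in> borel_measurable borel" and h0: "h 0 = 0"
  shows "(\<integral>\<^sup>+u. \<integral>\<^sup>+v. ennreal (h \<bar>u - v\<bar>) \<partial>nu \<partial>nu) = (\<integral>\<^sup>+t. ennreal (h t) \<partial>nu)"
proof -
  define e where "e u = ennreal (exp (- u)) * indicator {0..} u" for u :: real
  define F where "F u v = e u * e v * (ennreal (h (v - u)) * indicator {0<..} (v - u))" for u v
  define H where "H = (\<integral>\<^sup>+t. ennreal (h t) \<partial>nu)"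
  have [measurable]: "e \<in> borel_measurable borel" unfolding e_def by measurable
  have nu_e: "(\<integral>\<^sup>+u. f u \<partial>nu) = (\<integral>\<^sup>+u. e u * f u \<partial>lborel)" if "f \<in> borel_measurable borel" for f
    unfolding nn_integral_nu[OF measurable_nu_borel[OF that]] e_def
    by (intro nn_integral_cong) (simp add: mult_ac)
  have H: "H = (\<integral>\<^sup>+t. e t * (ennreal (h t) * indicator {0<..} t) \<partial>lborel)"
    unfolding H_def
    by (subst nu_e) (auto intro!: nn_integral_cong simp: e_def h0 less_le split: split_indicator)
  have [measurable]: "(\<lambda>(u, v). F u v) \<in> borel_measurable (borel \<Otimes>\<^sub>M borel)"
    unfolding F_def by measurable
  have inner: "(\<integral>\<^sup>+v. F u v \<partial>lborel) = ennreal (exp (- 2 * u)) * indicator {0..} u * H" for u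
  proof -
    have "(\<integral>\<^sup>+v. F u v \<partial>lborel) = ennreal \<bar>1\<bar> * (\<integral>\<^sup>+t. F u (u + 1 * t) \<partial>lborel)"
      by (rule nn_integral_real_affine) simp_all
    also have "\<dots> = (\<integral>\<^sup>+t. F u (u + 1 * t) \<partial>lborel)" by simp
    also have "\<dots> = (\<integral>\<^sup>+t. (ennreal (exp (- 2 * u)) * indicator {0..} u) * (e t * (ennreal (h t) * indicator {0<..} t)) \<partial>lborel)"
    proof (rule nn_integral_cong)
      fix t :: real
      have "ennreal (exp (- u)) * ennreal (exp (- (u + t))) = ennreal (exp (- 2 * u)) * ennreal (exp (- t))"
        by (simp add: ennreal_mult'[symmetric] exp_add[symmetric])
      then show "F u (u + 1 * t) = (ennreal (exp (- 2 * u)) * indicator {0..} u) *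
          (e t * (ennreal (h t) * indicator {0<..} t))"
        by (auto simp: F_def e_def mult.assoc[symmetric] split: split_indicator)
    qed
    also have "\<dots> = ennreal (exp (- 2 * u)) * indicator {0..} u * H"
      unfolding H by (rule nn_integral_cmult) measurable
    finally show ?thesis .
  qed
  \<comment> \<open>the total mass of the exponential measure, after the substitution \<open>u \<mapsto> 2 * u\<close>\<close>
  have half: "2 * (\<integral>\<^sup>+u. ennreal (exp (- 2 * u)) * indicator {0..} u \<partial>lborel) = 1"
  proof -
    have "1 = (\<integral>\<^sup>+u. e u \<partial>lborel)"
      using nu_e[of "\<lambda>_. 1"] nu.emeasure_space_1 by simp
    also have "\<dots> = ennreal \<bar>2\<bar> * (\<integral>\<^sup>+u. e (0 + 2 * u) \<partial>lborel)"
      by (rule nn_integral_real_affine) auto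
    also have "(\<lambda>u. e (0 + 2 * u)) = (\<lambda>u. ennreal (exp (- 2 * u)) * indicator {0..} u)"
      by (auto simp: e_def fun_eq_iff split: split_indicator)
    finally show ?thesis by simp
  qed
  have "(\<integral>\<^sup>+u. \<integral>\<^sup>+v. ennreal (h \<bar>u - v\<bar>) \<partial>nu \<partial>nu)
    = (\<integral>\<^sup>+u. \<integral>\<^sup>+v. e v * ennreal (h \<bar>u - v\<bar>) \<partial>lborel \<partial>nu)"
    by (subst nu_e) simp_all
  also have "\<dots> = (\<integral>\<^sup>+u. e u * (\<integral>\<^sup>+v. e v * ennreal (h \<bar>u - v\<bar>) \<partial>lborel) \<partial>lborel)"
    by (subst nu_e) simp_all
  also have "\<dots> = (\<integral>\<^sup>+u. \<integral>\<^sup>+v. e u * (e v * ennreal (h \<bar>u - v\<bar>)) \<partial>lborel \<partial>lborel)"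
    by (subst nn_integral_cmult) simp_all
  also have "\<dots> = (\<integral>\<^sup>+u. \<integral>\<^sup>+v. F u v + F v u \<partial>lborel \<partial>lborel)"
    by (intro nn_integral_cong) (auto simp: F_def h0 mult_ac abs_if split: split_indicator)
  also have "\<dots> = (\<integral>\<^sup>+u. \<integral>\<^sup>+v. F u v \<partial>lborel \<partial>lborel) + (\<integral>\<^sup>+u. \<integral>\<^sup>+v. F v u \<partial>lborel \<partial>lborel)"
    by (subst nn_integral_add[symmetric]) (simp_all add: nn_integral_add)
  also have "(\<integral>\<^sup>+u. \<integral>\<^sup>+v. F v u \<partial>lborel \<partial>lborel) = (\<integral>\<^sup>+u. \<integral>\<^sup>+v. F u v \<partial>lborel \<partial>lborel)"
    by (rule lborel_pair.Fubini') simp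
  also have "(\<integral>\<^sup>+u. \<integral>\<^sup>+v. F u v \<partial>lborel \<partial>lborel) = (\<integral>\<^sup>+u. ennreal (exp (- 2 * u)) * indicator {0..} u \<partial>lborel) * H"
    unfolding inner by (rule nn_integral_multc) measurable
  finally show ?thesis
    using half by (simp add: H_def[symmetric] mult_2[symmetric] mult.assoc[symmetric])
qed

lemma integral_nu_distance:
  fixes h :: "real \<Rightarrow> real"
  assumes h [measurable]: "h \<in> borel_measurable borel" and h0: "h 0 = 0"
    and nonneg: "\<And>t. 0 \<le> h t"
    and int: "\<And>u. 0 \<le> u \<Longrightarrow> integrable nu (\<lambda>v. h \<bar>u - v\<bar>)"
  shows "(\<integral>u. \<integral>v. h \<bar>u - v\<bar> \<partial>nu \<partial>nu) = (\<integral>t. h t \<partial>nu)"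
proof -
  have "(\<lambda>u. \<integral>v. indicator {0..} v * (exp (- v) * h \<bar>u - v\<bar>) \<partial>lborel) \<in> borel_measurable borel"
    by measurable
  also have "(\<lambda>u. \<integral>v. indicator {0..} v * (exp (- v) * h \<bar>u - v\<bar>) \<partial>lborel) = (\<lambda>u. \<integral>v. h \<bar>u - v\<bar> \<partial>nu)"
    by (subst integral_nu) (auto intro!: measurable_nu_borel)
  finally have meas: "(\<lambda>u. \<integral>v. h \<bar>u - v\<bar> \<partial>nu) \<in> borel_measurable nu" by (rule measurable_nu_borel)
  have "(\<integral>u. \<integral>v. h \<bar>u - v\<bar> \<partial>nu \<partial>nu) = enn2real (\<integral>\<^sup>+u. ennreal (\<integral>v. h \<bar>u - v\<bar> \<partial>nu) \<partial>nu)"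
    by (rule integral_eq_nn_integral[OF meas]) (simp add: nonneg)
  also have "(\<integral>\<^sup>+u. ennreal (\<integral>v. h \<bar>u - v\<bar> \<partial>nu) \<partial>nu) = (\<integral>\<^sup>+u. \<integral>\<^sup>+v. ennreal (h \<bar>u - v\<bar>) \<partial>nu \<partial>nu)"
    using int nonneg by (intro nn_integral_cong nn_integral_eq_integral[symmetric]) auto
  also have "\<dots> = (\<integral>\<^sup>+t. ennreal (h t) \<partial>nu)" by (rule nn_integral_nu_distance[OF h h0])
  also have "enn2real \<dots> = (\<integral>t. h t \<partial>nu)"
    by (rule integral_eq_nn_integral[symmetric]) (auto simp: nonneg intro: measurable_nu_borel)
  finally show ?thesis .
qed

lemma kern_column_integrable:
  assumes "0 < \<alpha>" "\<alpha> < 1 / 2" "0 < \<kappa>" "0 \<le> u"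
  shows "integrable nu (kern (2 * \<alpha>) \<kappa> u)"
proof -
  interpret K: compact_positive_kernel nu "kern \<alpha> \<kappa>" "singular_profile.C \<alpha>" "\<rat> \<inter> {0..}"
    using assms by (intro kern_compact_positive)
  have "integrable nu (\<lambda>v. (kern \<alpha> \<kappa> u v)\<^sup>2)"
    using K.column_L2[of u] assms by (simp add: L2_def)
  then show ?thesis unfolding kern_square[OF assms(3)] by simp
qed

lemma kern_measurable:
  assumes "0 < \<kappa>"
  shows "(\<lambda>t. kern \<beta> \<kappa> t 0) \<in> borel_measurable borel"
proof (cases \<kappa>)
  case (real r) show ?thesis unfolding real kern_real sinh_def by measurable
next
  case PInf show ?thesis unfolding PInf kern_infinity by measurable
qed (use assms in simp)

lemma kern_sym: "kern \<beta> \<kappa> u v = kern \<beta> \<kappa> v u"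
  by (cases \<kappa>) (simp_all add: kern_def abs_minus_commute)

lemma trace_T_sq_eq:
  assumes \<alpha>: "0 < \<alpha>" "\<alpha> < 1 / 2" and \<kappa>: "0 < \<kappa>" "\<kappa> = 1 - d - \<alpha>"
  shows "trace_T_sq \<alpha> d = \<kappa> powr (2 * \<alpha> - 2) * (\<integral>t. kern (2 * \<alpha>) (ereal \<kappa>) t 0 \<partial>nu)"
proof -
  define I where "I = (\<lambda>x. \<integral>y. x powr (- d) * y powr (- d) * \<bar>x - y\<bar> powr (- 2 * \<alpha>) \<partial>unit_leb)"
  have "I = (\<lambda>x. \<integral>y. indicator {0<..<1} y *
      (x powr (- d) * y powr (- d) * \<bar>x - y\<bar> powr (- 2 * \<alpha>)) \<partial>lborel)"
    by (simp add: I_def integral_restrict_space)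
  then have I_meas: "I \<in> borel_measurable borel" by simp
  have I_chart: "(weight \<kappa> u)\<^sup>2 / \<kappa> * I (chart \<kappa> u)
    = \<kappa> powr (2 * \<alpha> - 2) * (\<integral>v. kern (2 * \<alpha>) (ereal \<kappa>) u v \<partial>nu)" for u
  proof -
    have w: "weight \<kappa> u \<noteq> 0" using weight_pos[OF \<kappa>(1), of u] by simp
    have "I (chart \<kappa> u) = (\<integral>v. (weight \<kappa> v)\<^sup>2 / \<kappa> *
        (chart \<kappa> u powr (- d) * chart \<kappa> v powr (- d) * \<bar>chart \<kappa> u - chart \<kappa> v\<bar> powr (- 2 * \<alpha>)) \<partial>nu)"
      unfolding I_def by (rule integral_unit_leb[OF \<kappa>(1)]) measurable
    also have "\<dots> = (\<integral>v. \<kappa> powr (2 * \<alpha>) / \<kappa> / (weight \<kappa> u)\<^sup>2 * kern (2 * \<alpha>) (ereal \<kappa>) u v \<partial>nu)"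
    proof (rule Bochner_Integration.integral_cong[OF refl])
      fix v
      define E where "E = exp ((d / 2 + \<alpha> / 2) * (u + v) / \<kappa>)"
      have E2: "exp ((d + 2 * \<alpha> / 2) * (u + v) / \<kappa>) = E\<^sup>2"
      proof -
        have "(d + 2 * \<alpha> / 2) * (u + v) / \<kappa> = 2 * ((d / 2 + \<alpha> / 2) * (u + v) / \<kappa>)"
          using \<kappa>(1) by (simp add: field_simps)
        then show ?thesis by (simp only: E_def exp_double)
      qed
      have "(weight \<kappa> u * weight \<kappa> v * E)\<^sup>2 = 1"
        using weight_kernel_cancel[OF \<kappa>, of u v] by (simp add: E_def)
      then have "(weight \<kappa> v)\<^sup>2 * E\<^sup>2 = 1 / (weight \<kappa> u)\<^sup>2"
        using w by (simp add: power_mult_distrib field_simps)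
      moreover have "(weight \<kappa> v)\<^sup>2 / \<kappa> * (\<kappa> powr (2 * \<alpha>) * E\<^sup>2 * kern (2 * \<alpha>) (ereal \<kappa>) u v)
        = \<kappa> powr (2 * \<alpha>) / \<kappa> * ((weight \<kappa> v)\<^sup>2 * E\<^sup>2) * kern (2 * \<alpha>) (ereal \<kappa>) u v"
        by simp
      ultimately have "(weight \<kappa> v)\<^sup>2 / \<kappa> * (\<kappa> powr (2 * \<alpha>) * E\<^sup>2 * kern (2 * \<alpha>) (ereal \<kappa>) u v)
        = \<kappa> powr (2 * \<alpha>) / \<kappa> / (weight \<kappa> u)\<^sup>2 * kern (2 * \<alpha>) (ereal \<kappa>) u v"
        by simp
      then show "(weight \<kappa> v)\<^sup>2 / \<kappa> *
        (chart \<kappa> u powr (- d) * chart \<kappa> v powr (- d) * \<bar>chart \<kappa> u - chart \<kappa> v\<bar> powr (- 2 * \<alpha>))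
        = \<kappa> powr (2 * \<alpha>) / \<kappa> / (weight \<kappa> u)\<^sup>2 * kern (2 * \<alpha>) (ereal \<kappa>) u v"
        using chart_kernel[OF \<kappa>(1), of u d v "2 * \<alpha>"] unfolding E2 by simp
    qed
    also have "\<dots> = \<kappa> powr (2 * \<alpha>) / \<kappa> / (weight \<kappa> u)\<^sup>2 * (\<integral>v. kern (2 * \<alpha>) (ereal \<kappa>) u v \<partial>nu)"
      by (rule integral_mult_right_zero)
    finally show ?thesis
      using w \<kappa>(1) by (simp add: powr_diff power2_eq_square)
  qed
  have "trace_T_sq \<alpha> d = (\<integral>x. I x \<partial>unit_leb)" by (simp add: trace_T_sq_def I_def)
  also have "\<dots> = (\<integral>u. (weight \<kappa> u)\<^sup>2 / \<kappa> * I (chart \<kappa> u) \<partial>nu)"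
    by (rule integral_unit_leb[OF \<kappa>(1) I_meas])
  also have "\<dots> = \<kappa> powr (2 * \<alpha> - 2) * (\<integral>u. \<integral>v. kern (2 * \<alpha>) (ereal \<kappa>) u v \<partial>nu \<partial>nu)"
    unfolding I_chart by (rule integral_mult_right_zero)
  also have "(\<integral>u. \<integral>v. kern (2 * \<alpha>) (ereal \<kappa>) u v \<partial>nu \<partial>nu)
    = (\<integral>u. \<integral>v. kern (2 * \<alpha>) (ereal \<kappa>) \<bar>u - v\<bar> 0 \<partial>nu \<partial>nu)"
    by (simp only: kern_diff)
  also have "\<dots> = (\<integral>t. kern (2 * \<alpha>) (ereal \<kappa>) t 0 \<partial>nu)"
  proof (rule integral_nu_distance)
    show "integrable nu (\<lambda>v. kern (2 * \<alpha>) (ereal \<kappa>) \<bar>u - v\<bar> 0)" if "0 \<le> u" for u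
      unfolding kern_diff using kern_column_integrable[OF \<alpha> _ that] \<kappa>(1) by simp
  qed (use \<kappa>(1) in \<open>auto simp: kern_nonneg kern_measurable\<close>, simp add: kern_real)
  finally show ?thesis .
qed

section \<open>The normalizing constants\<close>

lemma Zconst_real_eq:
  assumes \<kappa>: "0 < \<kappa>" and s: "0 < s" "s < 1"
  shows "Zconst s (ereal \<kappa>) = (\<integral>t. kern s (ereal \<kappa>) t 0 \<partial>nu)"
proof -
  define a where "a = \<kappa> + s / 2"
  let ?f = "\<lambda>x::real. x powr (a - 1) * (1 - x) powr (1 - s - 1)"
  have a: "0 < a" using \<kappa> s by (simp add: a_def)
  have "Beta a (1 - s) = (\<integral>x. ?f x \<partial>unit_leb)"
  proof -
    have "set_integrable lborel {0..1} ?f" by (rule integrable_Beta) (use a s in auto)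
    then have "(LBINT x:{0..1}. ?f x) = integral {0..1} ?f" by (rule set_borel_integral_eq_integral)
    also have "\<dots> = Beta a (1 - s)"
      using has_integral_Beta_real[of a "1 - s"] a s by (simp add: has_integral_iff)
    finally have "Beta a (1 - s) = (\<integral>x. indicator {0..1} x * ?f x \<partial>lborel)"
      by (simp add: set_lebesgue_integral_def)
    also have "\<dots> = (\<integral>x. indicator {0<..<1} x * ?f x \<partial>lborel)"
    proof (rule integral_cong_AE)
      show "AE x in lborel. indicator {0..1} x * ?f x = indicator {0<..<1} x * ?f x"
        using AE_lborel_singleton[of "0::real"] AE_lborel_singleton[of "1::real"]
        by eventually_elim (auto split: split_indicator)
    qed measurable
    finally show ?thesis by (simp add: integral_restrict_space)
  qed
  also have "\<dots> = (\<integral>t. (weight \<kappa> t)\<^sup>2 / \<kappa> * ?f (chart \<kappa> t) \<partial>nu)"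
    by (rule integral_unit_leb[OF \<kappa>]) measurable
  also have "\<dots> = (\<integral>t. \<kappa> powr (s - 1) * kern s (ereal \<kappa>) t 0 \<partial>nu)"
  proof (rule Bochner_Integration.integral_cong[OF refl])
    fix t :: real assume "t \<in> space nu"
    then have t: "0 \<le> t" by simp
    have one: "chart \<kappa> 0 = 1" by (simp add: chart_def[OF \<kappa>])
    have "\<bar>chart \<kappa> t - 1\<bar> = 1 - chart \<kappa> t" "chart \<kappa> t \<noteq> 0"
      using t \<kappa> by (simp_all add: chart_def[OF \<kappa>])
    then have "(1 - chart \<kappa> t) powr (1 - s - 1) = \<kappa> powr s * exp (s / 2 * t / \<kappa>) * kern s (ereal \<kappa>) t 0"
      using chart_kernel[OF \<kappa>, of t 0 0 s] by (simp add: one)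
    moreover have "chart \<kappa> t powr (a - 1) = exp (- (t / \<kappa>) * (a - 1))"
      by (simp add: chart_def[OF \<kappa>] exp_powr_real)
    moreover have "exp (t - t / \<kappa>) * exp (- (t / \<kappa>) * (a - 1)) * exp (s / 2 * t / \<kappa>) = 1"
      unfolding exp_add[symmetric] using \<kappa> by (simp add: a_def field_simps)
    moreover have "exp (t - t / \<kappa>) * (exp (- (t / \<kappa>) * (a - 1)) * (\<kappa> powr s * exp (s / 2 * t / \<kappa>) * kern s (ereal \<kappa>) t 0))
      = \<kappa> powr s * kern s (ereal \<kappa>) t 0 * (exp (t - t / \<kappa>) * exp (- (t / \<kappa>) * (a - 1)) * exp (s / 2 * t / \<kappa>))"
      by (simp only: mult_ac)
    ultimately have "(weight \<kappa> t)\<^sup>2 * ?f (chart \<kappa> t) = \<kappa> powr s * kern s (ereal \<kappa>) t 0"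
      unfolding weight_square[OF \<kappa>] by (simp only: mult_1_right)
    then have "(weight \<kappa> t)\<^sup>2 / \<kappa> * ?f (chart \<kappa> t) = \<kappa> powr s * kern s (ereal \<kappa>) t 0 / \<kappa>"
      unfolding times_divide_eq_left by (rule arg_cong)
    then show "(weight \<kappa> t)\<^sup>2 / \<kappa> * ?f (chart \<kappa> t) = \<kappa> powr (s - 1) * kern s (ereal \<kappa>) t 0"
      using \<kappa> by (simp only: powr_diff powr_one) simp
  qed
  also have "\<dots> = \<kappa> powr (s - 1) * (\<integral>t. kern s (ereal \<kappa>) t 0 \<partial>nu)"
    by (rule integral_mult_right_zero)
  finally have "Zconst s (ereal \<kappa>) = \<kappa> powr (1 - s) * (\<kappa> powr (s - 1) * (\<integral>t. kern s (ereal \<kappa>) t 0 \<partial>nu))"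
    by (simp add: Zconst_def a_def)
  also have "\<dots> = (\<integral>t. kern s (ereal \<kappa>) t 0 \<partial>nu)"
    using \<kappa> unfolding mult.assoc[symmetric] by (simp add: powr_add[symmetric])
  finally show ?thesis .
qed

lemma Gamma_eq_integral_nu:
  assumes s: "s < 1"
  shows "Gamma (1 - s) = (\<integral>t. kern s \<infinity> t 0 \<partial>nu)"
proof -
  have meas: "(\<lambda>t. kern s \<infinity> t 0) \<in> borel_measurable nu"
    by (rule measurable_nu_borel, rule kern_measurable) simp
  have "ennreal (Gamma (1 - s)) = (\<integral>\<^sup>+t. ennreal (indicator {0..} t * t powr (1 - s - 1) / exp t) \<partial>lborel)"
    using s by (rule_tac Gamma_conv_nn_integral_real) simp
  also have "\<dots> = (\<integral>\<^sup>+t. ennreal (exp (- t)) * ennreal (kern s \<infinity> t 0) * indicator {0..} t \<partial>lborel)"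
    by (intro nn_integral_cong)
      (auto simp: kern_infinity exp_minus divide_inverse ennreal_mult'[symmetric] mult.commute split: split_indicator)
  also have "\<dots> = (\<integral>\<^sup>+t. ennreal (kern s \<infinity> t 0) \<partial>nu)"
    using meas by (intro nn_integral_nu[symmetric]) simp
  finally have "enn2real (ennreal (Gamma (1 - s))) = (\<integral>t. kern s \<infinity> t 0 \<partial>nu)"
    using meas by (subst integral_eq_nn_integral) (simp_all add: kern_nonneg)
  then show ?thesis using Gamma_real_pos[of "1 - s"] s by simp
qed

lemma Zconst_perturbation:
  assumes \<alpha>: "0 < \<alpha>" "\<alpha> < 1 / 2" and r: "0 < r"
  shows "Zconst (2 * \<alpha>) (ereal r) \<le> Gamma (1 - 2 * \<alpha>)"
    and "Gamma (1 - 2 * \<alpha>) \<le> Zconst (2 * \<alpha>) (ereal r) + 1 / (4 * r\<^sup>2) * (\<integral>t. 1 + t\<^sup>2 \<partial>nu)"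
proof -
  have int: "integrable nu (\<lambda>t. kern (2 * \<alpha>) \<kappa> t 0)" if "0 < \<kappa>" for \<kappa>
    using kern_column_integrable[OF \<alpha> that, of 0] unfolding kern_sym[of _ _ 0] by simp
  have p: "integrable nu (\<lambda>t::real. 1 + t\<^sup>2)"
    using integrable_nu_power[of 2] by simp
  have Z: "Zconst (2 * \<alpha>) (ereal r) = (\<integral>t. kern (2 * \<alpha>) (ereal r) t 0 \<partial>nu)"
    using \<alpha> r by (intro Zconst_real_eq) auto
  have G: "Gamma (1 - 2 * \<alpha>) = (\<integral>t. kern (2 * \<alpha>) \<infinity> t 0 \<partial>nu)"
    using \<alpha> by (intro Gamma_eq_integral_nu) auto
  show "Zconst (2 * \<alpha>) (ereal r) \<le> Gamma (1 - 2 * \<alpha>)"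
    unfolding Z G using \<alpha> r by (intro integral_mono int kern_le_kern_infinity) auto
  have "Gamma (1 - 2 * \<alpha>) \<le> (\<integral>t. kern (2 * \<alpha>) (ereal r) t 0 + 1 / (4 * r\<^sup>2) * (1 + t\<^sup>2) \<partial>nu)"
    unfolding G
  proof (rule integral_mono)
    show "integrable nu (\<lambda>t. kern (2 * \<alpha>) (ereal r) t 0 + 1 / (4 * r\<^sup>2) * (1 + t\<^sup>2))"
      using int[of "ereal r"] p r by simp
    fix t :: real assume "t \<in> space nu"
    then show "kern (2 * \<alpha>) \<infinity> t 0 \<le> kern (2 * \<alpha>) (ereal r) t 0 + 1 / (4 * r\<^sup>2) * (1 + t\<^sup>2)"
      using kern_infinity_le[OF r, of "2 * \<alpha>" t 0] \<alpha> by simp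
  qed (use int in simp)
  also have "\<dots> = Zconst (2 * \<alpha>) (ereal r) + 1 / (4 * r\<^sup>2) * (\<integral>t. 1 + t\<^sup>2 \<partial>nu)"
    unfolding Z using int[of "ereal r"] p r
    by (subst Bochner_Integration.integral_add) (simp_all only: integral_mult_right_zero integrable_mult_right ereal_less)
  finally show "Gamma (1 - 2 * \<alpha>) \<le> Zconst (2 * \<alpha>) (ereal r) + 1 / (4 * r\<^sup>2) * (\<integral>t. 1 + t\<^sup>2 \<partial>nu)" .
qed

section \<open>The constant and its asymptotics\<close>

lemma Lambda2_eq:
  assumes \<alpha>: "0 < \<alpha>" "\<alpha> < 1 / 2" and \<kappa>: "0 < \<kappa>" "\<kappa> = 1 - d - \<alpha>"
  shows "Lambda2 \<alpha> d = D2 \<alpha> (ereal \<kappa>) / sqrt (2 * Zconst (2 * \<alpha>) (ereal \<kappa>))"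
proof -
  define q where "q = \<kappa> powr (\<alpha> - 1)"
  have q: "0 < q" using \<kappa>(1) by (simp add: q_def)
  have q2: "\<kappa> powr (2 * \<alpha> - 2) = q\<^sup>2"
    using \<kappa>(1) by (simp add: q_def power2_eq_square powr_add[symmetric])
  have "trace_T_sq \<alpha> d = q\<^sup>2 * Zconst (2 * \<alpha>) (ereal \<kappa>)"
    using trace_T_sq_eq[OF \<alpha> \<kappa>] Zconst_real_eq[OF \<kappa>(1), of "2 * \<alpha>"] \<alpha> by (simp add: q2)
  then have "sqrt (2 * trace_T_sq \<alpha> d) = q * sqrt (2 * Zconst (2 * \<alpha>) (ereal \<kappa>))"
    using q by (simp add: real_sqrt_mult)
  moreover have "lambda_max unit_leb (T_op \<alpha> d) = q * D2 \<alpha> (ereal \<kappa>)"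
    unfolding q_def by (rule lambda_max_T_op[OF \<alpha> \<kappa>])
  ultimately show ?thesis using q by (simp add: Lambda2_def)
qed

lemma quotient_sqrt_error:
  fixes a b :: real
  assumes a: "0 \<le> a" "a \<le> 1" and b: "0 \<le> b" "b \<le> 1 / 2"
  shows "\<bar>(1 - a) / sqrt (1 - b) - 1\<bar> \<le> a + 2 * b"
proof -
  have s: "1 - b \<le> sqrt (1 - b)" "sqrt (1 - b) \<le> 1" "0 < sqrt (1 - b)"
    using b by (auto intro!: real_le_rsqrt simp: power2_eq_square mult_le_cancel_right1)
  have "1 - a \<le> (1 - a) / sqrt (1 - b)"
    using s a by (simp add: le_divide_eq mult_left_le)
  moreover have "(1 - a) / sqrt (1 - b) \<le> 1 / sqrt (1 - b)"
    using s a by (intro divide_right_mono) auto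
  moreover have "1 / sqrt (1 - b) \<le> 1 / (1 - b)"
    using s b by (intro divide_left_mono) auto
  moreover have "1 / (1 - b) \<le> 1 + 2 * b"
  proof -
    have "0 \<le> b * (1 - 2 * b)" using b by simp
    then show ?thesis using b by (simp add: divide_le_eq algebra_simps)
  qed
  ultimately show ?thesis using a b by linarith
qed

text \<open>
The relative errors \<open>a\<close> of the largest eigenvalue and \<open>b\<close> of the normalizing constant are both of order \<open>1 / r\<^sup>2\<close>
with \<open>r = 1 - d - \<alpha> \<ge> (1 - d) / 2\<close>, and the quotient depends on them in a Lipschitz manner as long as \<open>b \<le> 1 / 2\<close>.
\<close>

lemma Lambda2_ratio_bigo:
  assumes \<alpha>: "0 < \<alpha>" "\<alpha> < 1 / 2"
  shows "(\<lambda>d. Lambda2 \<alpha> d / Lambda2_exp \<alpha> - 1) \<in> O[at_bot](\<lambda>d. 1 / (1 - d)\<^sup>2)"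
proof -
  define D where "D = D2 \<alpha> \<infinity>"
  define G where "G = Gamma (1 - 2 * \<alpha>)"
  define p where "p = (\<integral>u. (1 + u\<^sup>2)\<^sup>2 \<partial>nu) / (4 * D)"
  define q where "q = (\<integral>t. 1 + t\<^sup>2 \<partial>nu) / (4 * G)"
  have D: "0 < D" using D2_pos[OF \<alpha>, of \<infinity>] by (simp add: D_def)
  have G: "0 < G" using \<alpha> by (simp add: G_def Gamma_real_pos)
  have p: "0 \<le> p" using D by (simp add: p_def)
  have q: "0 \<le> q" using G by (auto simp: q_def intro!: divide_nonneg_pos integral_nonneg_AE)
  have "\<bar>Lambda2 \<alpha> d / Lambda2_exp \<alpha> - 1\<bar> \<le> 4 * (p + 2 * q) * \<bar>1 / (1 - d)\<^sup>2\<bar>" if d: "d \<le> - 1 - 4 * q" for d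
  proof -
    define r where "r = 1 - d - \<alpha>"
    have r_ge: "(1 - d) / 2 \<le> r" "1 + 2 * q \<le> r" and d1: "0 < 1 - d"
      using d \<alpha> q by (simp_all add: r_def)
    have r: "0 < r" using r_ge q by simp
    have r2: "1 / r\<^sup>2 \<le> 4 * (1 / (1 - d)\<^sup>2)"
    proof -
      have "((1 - d) / 2)\<^sup>2 \<le> r\<^sup>2" using r_ge d1 by (intro power_mono) auto
      then show ?thesis using d1 r by (simp add: power_divide field_simps)
    qed
    define a where "a = 1 - D2 \<alpha> (ereal r) / D"
    define b where "b = 1 - Zconst (2 * \<alpha>) (ereal r) / G"
    have "a = (D - D2 \<alpha> (ereal r)) / D" using D by (simp add: a_def diff_divide_distrib)
    also have "\<dots> \<le> (1 / (4 * r\<^sup>2) * (\<integral>u. (1 + u\<^sup>2)\<^sup>2 \<partial>nu)) / D"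
      using D2_perturbation(2)[OF \<alpha> r] D unfolding D_def[symmetric] by (intro divide_right_mono) auto
    also have "\<dots> = p * (1 / r\<^sup>2)" by (simp add: p_def)
    finally have a_le: "a \<le> p * (1 / r\<^sup>2)" .
    have a: "0 \<le> a" "a \<le> 1"
      using D2_perturbation(1)[OF \<alpha> r] D2_pos[OF \<alpha>, of "ereal r"] D r
      by (simp_all add: a_def D_def[symmetric])
    have "b = (G - Zconst (2 * \<alpha>) (ereal r)) / G" using G by (simp add: b_def diff_divide_distrib)
    also have "\<dots> \<le> (1 / (4 * r\<^sup>2) * (\<integral>t. 1 + t\<^sup>2 \<partial>nu)) / G"
      using Zconst_perturbation(2)[OF \<alpha> r] G unfolding G_def[symmetric] by (intro divide_right_mono) auto
    also have "\<dots> = q * (1 / r\<^sup>2)" by (simp add: q_def)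
    finally have b_le: "b \<le> q * (1 / r\<^sup>2)" .
    have "Zconst (2 * \<alpha>) (ereal r) \<le> G"
      using Zconst_perturbation(1)[OF \<alpha> r] unfolding G_def .
    then have b0: "0 \<le> b" using G by (simp add: b_def)
    have "2 * q \<le> r * r"
      using r_ge q mult_mono[of 1 r "2 * q" r] by simp
    then have "q * (1 / r\<^sup>2) \<le> 1 / 2" using r by (simp add: field_simps power2_eq_square)
    with b_le have b2: "b \<le> 1 / 2" by (rule order.trans)
    have "Lambda2 \<alpha> d / Lambda2_exp \<alpha> = (D2 \<alpha> (ereal r) / D) / (sqrt (2 * Zconst (2 * \<alpha>) (ereal r)) / sqrt (2 * G))"
      unfolding Lambda2_eq[OF \<alpha> r r_def] Lambda2_exp_def D2_def[symmetric] D_def[symmetric] G_def[symmetric] by simp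
    also have "\<dots> = (1 - a) / sqrt (1 - b)"
      unfolding real_sqrt_divide[symmetric] by (simp add: a_def b_def)
    finally have "\<bar>Lambda2 \<alpha> d / Lambda2_exp \<alpha> - 1\<bar> \<le> a + 2 * b"
      using quotient_sqrt_error[OF a b0 b2] by simp
    also have "\<dots> \<le> (p + 2 * q) * (1 / r\<^sup>2)"
      unfolding distrib_right mult.assoc using a_le b_le by linarith
    also have "\<dots> \<le> (p + 2 * q) * (4 * (1 / (1 - d)\<^sup>2))" using p q r2 by (intro mult_left_mono) auto
    finally show ?thesis
      unfolding abs_of_nonneg[OF zero_le_divide_1_iff[THEN iffD2, OF zero_le_power2]] by (simp only: mult_ac)
  qed
  then show ?thesis
    by (intro bigoI[where c = "4 * (p + 2 * q)"])
      (auto simp: eventually_at_bot_linorder intro!: exI[of _ "- 1 - 4 * q"])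
qed

theorem proposition6p1:
  fixes \<alpha> :: real
  assumes "0 < \<alpha>" and "\<alpha> < 1 / 2"
  shows "(\<forall>d \<kappa> :: real. 2 * d + 2 * \<alpha> < 1 \<longrightarrow> \<kappa> = 1 - d - \<alpha> \<longrightarrow>
            \<kappa> > 1 / 2 \<and>
            Lambda2 \<alpha> d = D2 \<alpha> (ereal \<kappa>) / sqrt (2 * Zconst (2 * \<alpha>) (ereal \<kappa>))) \<and>
         Lambda2_exp \<alpha> > 0 \<and>
         (\<exists>E :: real \<Rightarrow> real. E \<in> O[at_bot](\<lambda>d. 1 / (1 - d)\<^sup>2) \<and>
            (\<forall>d. 2 * d + 2 * \<alpha> < 1 \<longrightarrow> Lambda2 \<alpha> d = Lambda2_exp \<alpha> * (1 + E d)))"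
proof (intro conjI allI impI)
  fix d \<kappa> :: real
  assume d: "2 * d + 2 * \<alpha> < 1" and \<kappa>: "\<kappa> = 1 - d - \<alpha>"
  show "\<kappa> > 1 / 2" using d \<kappa> by simp
  then show "Lambda2 \<alpha> d = D2 \<alpha> (ereal \<kappa>) / sqrt (2 * Zconst (2 * \<alpha>) (ereal \<kappa>))"
    using assms \<kappa> by (intro Lambda2_eq) auto
next
  show pos: "Lambda2_exp \<alpha> > 0"
    using D2_pos[OF assms, of \<infinity>] Gamma_real_pos[of "1 - 2 * \<alpha>"] assms
    by (simp add: Lambda2_exp_def D2_def)
  show "\<exists>E :: real \<Rightarrow> real. E \<in> O[at_bot](\<lambda>d. 1 / (1 - d)\<^sup>2) \<and>
      (\<forall>d. 2 * d + 2 * \<alpha> < 1 \<longrightarrow> Lambda2 \<alpha> d = Lambda2_exp \<alpha> * (1 + E d))"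
    using Lambda2_ratio_bigo[OF assms] pos
    by (intro exI[of _ "\<lambda>d. Lambda2 \<alpha> d / Lambda2_exp \<alpha> - 1"]) simp
qed

end
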